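(* Let $\theta:=\inf\{t>0:\ |W(t)|=1\}$, $E_1:=\mathbb{E}\,\theta$ and $E_2:=\mathbb{E}\,(\theta^{-1})$. Then the taut string energy constant $\mathcal{C}$ (defined in the context) satisfies $$\mathcal{C}\le 2\sqrt{E_2/E_1},$$ where $E_1=1$ and $E_2=\int_0^\infty\frac{x}{\cosh x}\,dx$.
   Context: $W=(W(t))_{t\ge 0}$ is a standard one-dimensional Wiener process with $W(0)=0$. $\|h\|_1:=\sup_{0\le t\le 1}|h(t)|$; $AC[0,1]$ is the set of absolutely continuous real functions on $[0,1]$, and $|h|_1:=\left(\int_0^1 h'(t)^2\,dt\right)^{1/2}$ (possibly $+\infty$). For $\varepsilon>0$, $$I_W(1,\varepsilon):=\inf\{|h|_1:\ h\in AC[0,1],\ \|h-W\|_1\le\varepsilon,\ h(0)=0\}.$$ The constant $\mathcal{C}\in[0,\infty)$ is the (unique) deterministic number such that, for every $q>0$, $\mathbb{E}\left|\varepsilon I_W(1,\varepsilon)-\mathcal{C}\right|^q\to 0$ as $\varepsilon\to 0$; the existence of such a constant is another theorem of the paper. *)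

theory Defs
  imports "HOL-Probability.Probability"
begin

(* Only the values W t for t \<ge> 0 are constrained. *)
definition wiener_process :: "'a measure \<Rightarrow> (real \<Rightarrow> 'a \<Rightarrow> real) \<Rightarrow> bool" where
  "wiener_process M W \<longleftrightarrow>
     prob_space M \<and>
     (\<forall>t\<ge>0. W t \<in> borel_measurable M) \<and>
     (AE \<omega> in M. W 0 \<omega> = 0) \<and>
     (AE \<omega> in M. continuous_on {0..} (\<lambda>t. W t \<omega>)) \<and>
     (\<forall>s t. 0 \<le> s \<and> s < t \<longrightarrow>
        distributed M lborel (\<lambda>\<omega>. W t \<omega> - W s \<omega>) (\<lambda>x. ennreal (normal_density 0 (sqrt (t - s)) x))) \<and>
     (\<forall>(n::nat) (t::nat \<Rightarrow> real). 0 \<le> t 0 \<and> (\<forall>i<n. t i \<le> t (Suc i)) \<longrightarrow>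
        prob_space.indep_vars M (\<lambda>_. borel) (\<lambda>i \<omega>. W (t (Suc i)) \<omega> - W (t i) \<omega>) {..<n})"

(* HOL-Analysis has absolute continuity for measures only; this is the usual
   epsilon-delta notion for real functions, over finite families of
   non-overlapping subintervals. *)
definition abs_continuous_on :: "real \<Rightarrow> real \<Rightarrow> (real \<Rightarrow> real) \<Rightarrow> bool" where
  "abs_continuous_on a b h \<longleftrightarrow>
     (\<forall>e>0. \<exists>d>0. \<forall>(n::nat) (l::nat \<Rightarrow> real) (u::nat \<Rightarrow> real).
        (\<forall>i<n. a \<le> l i \<and> l i \<le> u i \<and> u i \<le> b) \<and>
        disjoint_family_on (\<lambda>i. {l i<..<u i}) {..<n} \<and>
        (\<Sum>i<n. u i - l i) < d
        \<longrightarrow> (\<Sum>i<n. \<bar>h (u i) - h (l i)\<bar>) < e)"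

(* Real powers on [0,\<infinity>], intended for exponents q > 0: \<infinity> powr q = \<infinity>. *)
definition ennreal_powr :: "ennreal \<Rightarrow> real \<Rightarrow> ennreal" where
  "ennreal_powr x q = (if x = top then top else ennreal (enn2real x powr q))"

definition sup_norm :: "(real \<Rightarrow> real) \<Rightarrow> ennreal" where
  "sup_norm h = (SUP t\<in>{0..1}. ennreal \<bar>h t\<bar>)"

(* Used for absolutely continuous h only: then deriv h is the derivative at almost
   every point of (0,1), and its arbitrary values elsewhere do not affect the integral. *)
definition energy_norm :: "(real \<Rightarrow> real) \<Rightarrow> ennreal" where
  "energy_norm h =
     ennreal_powr (\<integral>\<^sup>+t\<in>{0..1}. ennreal ((deriv h t)\<^sup>2) \<partial>lebesgue) (1/2)"

definition taut_string_energy :: "(real \<Rightarrow> real) \<Rightarrow> real \<Rightarrow> ennreal" where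
  "taut_string_energy w \<epsilon> =
     Inf {energy_norm h | h. abs_continuous_on 0 1 h \<and>
            sup_norm (\<lambda>t. h t - w t) \<le> ennreal \<epsilon> \<and> h 0 = 0}"

(* The expectation is a [0,\<infinity>]-valued integral, so convergence to 0 includes
   finiteness of the moments for small \<epsilon>. *)
definition is_taut_string_constant ::
    "'a measure \<Rightarrow> (real \<Rightarrow> 'a \<Rightarrow> real) \<Rightarrow> real \<Rightarrow> bool" where
  "is_taut_string_constant M W C \<longleftrightarrow>
     0 \<le> C \<and>
     (\<forall>q>0.
        ((\<lambda>\<epsilon>. \<integral>\<^sup>+\<omega>. ennreal_powr
             (e2ennreal \<bar>enn2ereal (ennreal \<epsilon> * taut_string_energy (\<lambda>t. W t \<omega>) \<epsilon>) - ereal C\<bar>) q \<partial>M)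
          \<longlongrightarrow> 0) (at_right 0))"

(* In ennreal the infimum of the empty set is \<infinity>. *)
definition exit_time :: "(real \<Rightarrow> 'a \<Rightarrow> real) \<Rightarrow> 'a \<Rightarrow> ennreal" where
  "exit_time W \<omega> = Inf {ennreal t | t. 0 < t \<and> \<bar>W t \<omega>\<bar> = 1}"

end

theory Submission
  imports Defs "HOL-Real_Asymp.Real_Asymp"
begin

text \<open>
  \<^emph>\<open>The law of the exit time.\<close> Let \<open>\<theta>\<close> be the first time at which \<open>\<bar>W\<bar> = 1\<close>. Optional stopping of the martingale
  \<open>cosh (a W(t)) exp (- a\<^sup>2 t / 2)\<close> gives \<open>E exp (- a\<^sup>2 \<theta> / 2) = 1 / cosh a\<close>. Its behaviour at \<open>a = 0\<close> gives
  \<open>E \<theta> = 1\<close>, and since \<open>1 / \<theta>\<close> is the integral of \<open>x exp (- x\<^sup>2 \<theta> / 2)\<close> over \<open>x \<ge> 0\<close>, Tonelli's theorem gives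
  \<open>E (1 / \<theta>) = \<integral> x / cosh x dx\<close>. Optional stopping is carried out for the Gaussian walk that arises from \<open>W\<close> on
  a fine grid, where it is a finite sum (\<open>mass_balance\<close>); the error committed because the walk jumps over
  the level is controlled in \<open>one_le_discounted_exit\<close>. The path is caught between walks at levels \<open>c < 1\<close>
  and \<open>1\<close>, see \<open>nn_integral_discount_exit_time\<close>.

  \<^emph>\<open>The bound for the constant.\<close> Fix the radius \<open>\<epsilon>\<close>. Follow \<open>W\<close> until it has moved by \<open>\<epsilon> / 2\<close>, restart there, and so on;
  the string \<open>h\<close> interpolates \<open>W\<close> linearly between the restarts. Within one piece both \<open>W\<close> and \<open>h\<close> are within
  \<open>\<epsilon> / 2\<close> of the starting position, so \<open>h\<close> is admissible. A piece of duration \<open>T\<close> costs the energy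
  \<open>(\<epsilon> / 2)\<^sup>2 / T\<close>; by scaling its mean is \<open>E2 = E (1 / \<theta>)\<close>, while a piece lasts \<open>(\<epsilon> / 2)\<^sup>2 E1\<close> on average. Hence the mean
  energy on \<open>[0, 1]\<close> is about \<open>4 E2 / (\<epsilon>\<^sup>2 E1)\<close>, and after multiplication with \<open>\<epsilon>\<^sup>2\<close> this is the square of the
  asserted bound.

  The count of the pieces is made rigorous without renewal theory and without the strong Markov property.
  The construction is run on a grid of mesh \<open>\<delta>\<close>, and an explicit potential, built from the same \<open>cosh\<close>
  martingales, shows that the mean cost on \<open>[0, 1]\<close> is at most \<open>K (1 + 1 / r\<^sup>2)\<close>, where \<open>r\<close> is slightly smaller than
  \<open>\<epsilon> / 2\<close> and \<open>K\<close> close to \<open>E2\<close> (\<open>expected_cost_le\<close>). The discrete string is admissible as soon as \<open>W\<close> oscillates little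
  over the mesh (\<open>taut_string_energy_le_cost\<close>). For fixed \<open>\<epsilon>\<close> the probability of this tends to 1 as
  \<open>\<delta>\<close> tends to 0, whereas the bound for the mean cost does not depend on \<open>\<delta>\<close>. This order of the limits makes it
  unnecessary to repair the string on the exceptional event.
\<close>

section \<open>Walks with independent Gaussian steps\<close>

locale gaussian_walk = prob_space M for M :: "'a measure" +
  fixes \<xi> :: "nat \<Rightarrow> 'a \<Rightarrow> real" and \<delta> :: real
  assumes step_pos: "0 < \<delta>"
    and steps_indep: "\<And>n. indep_vars (\<lambda>_. borel) \<xi> {..<n}"
    and steps_normal: "\<And>k. distributed M lborel (\<xi> k) (\<lambda>x. ennreal (normal_density 0 (sqrt \<delta>) x))"
begin

lemma step_measurable [measurable]: "\<xi> k \<in> borel_measurable M"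
  using distributed_measurable[OF steps_normal[of k]] by simp

lemma steps_measurable [measurable]: "(\<lambda>\<omega>. restrict (\<lambda>i. \<xi> i \<omega>) A) \<in> M \<rightarrow>\<^sub>M PiM A (\<lambda>_. borel)"
  by (intro measurable_restrict) auto

text \<open>Throughout, a function of the first \<open>k\<close> steps is a function \<open>F\<close> of the whole step sequence that is
measurable for the product over \<open>{..<k}\<close> and blind to the later coordinates. For functions defined by
recursion along the walk both properties follow by induction, and independence of the next step from
the past then applies to them without naming a filtration.\<close>
lemma past_random_variable:
  assumes "F \<in> borel_measurable (PiM {..<k} (\<lambda>_. borel))" "\<And>x. F (restrict x {..<k}) = F x"
  shows "(\<lambda>\<omega>. F (\<lambda>i. \<xi> i \<omega>)) \<in> borel_measurable M"
proof -
  have "(\<lambda>\<omega>. F (restrict (\<lambda>i. \<xi> i \<omega>) {..<k})) \<in> borel_measurable M"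
    by (rule measurable_compose[OF steps_measurable assms(1)])
  then show ?thesis by (simp add: assms(2))
qed

lemma indep_past_next:
  fixes F :: "(nat \<Rightarrow> real) \<Rightarrow> 'b::topological_space" and g :: "real \<Rightarrow> 'b"
  assumes F: "F \<in> borel_measurable (PiM {..<k} (\<lambda>_. borel))" "\<And>x. F (restrict x {..<k}) = F x"
    and g: "g \<in> borel_measurable borel"
  shows "indep_var borel (\<lambda>\<omega>. F (\<lambda>i. \<xi> i \<omega>)) borel (\<lambda>\<omega>. g (\<xi> k \<omega>))"
proof -
  have "indep_var (PiM {..<k} (\<lambda>_. borel)) (\<lambda>\<omega>. restrict (\<lambda>i. \<xi> i \<omega>) {..<k})
          (PiM {k} (\<lambda>_. borel)) (\<lambda>\<omega>. restrict (\<lambda>i. \<xi> i \<omega>) {k})"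
    by (rule indep_var_restrict[OF steps_indep[of "Suc k"]]) auto
  moreover have "(\<lambda>x. g (x k)) \<in> borel_measurable (PiM {k} (\<lambda>_. borel))"
    using g by measurable
  ultimately show ?thesis
    using indep_var_compose[of _ _ _ _ F borel "\<lambda>x. g (x k)" borel] F(1)
    by (fastforce simp: comp_def F(2))
qed

lemma nn_integral_past_times_next:
  fixes F :: "(nat \<Rightarrow> real) \<Rightarrow> ennreal"
  assumes "F \<in> borel_measurable (PiM {..<k} (\<lambda>_. borel))" "\<And>x. F (restrict x {..<k}) = F x"
    and "g \<in> borel_measurable borel"
  shows "(\<integral>\<^sup>+\<omega>. F (\<lambda>i. \<xi> i \<omega>) * g (\<xi> k \<omega>) \<partial>M) = (\<integral>\<^sup>+\<omega>. F (\<lambda>i. \<xi> i \<omega>) \<partial>M) * (\<integral>\<^sup>+\<omega>. g (\<xi> k \<omega>) \<partial>M)"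
proof -
  let ?Y = "case_bool (\<lambda>\<omega>. F (\<lambda>i. \<xi> i \<omega>)) (\<lambda>\<omega>. g (\<xi> k \<omega>))"
  have "indep_vars (case_bool borel borel) ?Y UNIV"
    using indep_past_next[OF assms] by (simp add: indep_var_def)
  also have "case_bool borel borel = (\<lambda>_. borel :: ennreal measure)"
    by (auto split: bool.split)
  finally have "(\<integral>\<^sup>+\<omega>. (\<Prod>i\<in>UNIV. ?Y i \<omega>) \<partial>M) = (\<Prod>i\<in>UNIV. \<integral>\<^sup>+\<omega>. ?Y i \<omega> \<partial>M)"
    by (intro indep_vars_nn_integral) auto
  then show ?thesis by (simp add: UNIV_bool mult.commute)
qed

lemma nn_integral_exp_step: "(\<integral>\<^sup>+\<omega>. ennreal (exp (a * \<xi> k \<omega>)) \<partial>M) = ennreal (exp (a\<^sup>2 * \<delta> / 2))"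
proof -
  have *: "normal_density 0 (sqrt \<delta>) x * exp (a * x) = exp (a\<^sup>2 * \<delta> / 2) * normal_density (a * \<delta>) (sqrt \<delta>) x" for x
    using step_pos unfolding normal_density_def
    by (simp add: exp_add[symmetric] field_simps power2_eq_square)
  have "(\<integral>\<^sup>+\<omega>. ennreal (exp (a * \<xi> k \<omega>)) \<partial>M) = (\<integral>\<^sup>+x. ennreal (normal_density 0 (sqrt \<delta>) x) * ennreal (exp (a * x)) \<partial>lborel)"
    by (subst distributed_nn_integral[OF steps_normal]) auto
  also have "\<dots> = (\<integral>\<^sup>+x. ennreal (exp (a\<^sup>2 * \<delta> / 2)) * ennreal (normal_density (a * \<delta>) (sqrt \<delta>) x) \<partial>lborel)"
    by (simp add: ennreal_mult'[symmetric] *)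
  also have "\<dots> = ennreal (exp (a\<^sup>2 * \<delta> / 2))"
    using step_pos by (subst nn_integral_cmult) (auto simp: nn_integral_eq_integral)
  finally show ?thesis .
qed

text \<open>The process \<open>cosh (a S\<^sub>k) exp (- a\<^sup>2 \<delta> k / 2)\<close> is a martingale for the Gaussian walk of step variance \<open>\<delta>\<close>, exactly
and not only in the limit of small steps. Writing \<open>cosh\<close> as half the sum of two exponentials keeps all
integrands nonnegative, so that no integrability has to be checked.\<close>
lemma nn_integral_cosh_martingale:
  fixes F :: "(nat \<Rightarrow> real) \<Rightarrow> ennreal" and X :: "(nat \<Rightarrow> real) \<Rightarrow> real"
  assumes F: "F \<in> borel_measurable (PiM {..<k} (\<lambda>_. borel))" "\<And>x. F (restrict x {..<k}) = F x"
    and X: "X \<in> borel_measurable (PiM {..<k} (\<lambda>_. borel))" "\<And>x. X (restrict x {..<k}) = X x"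
  shows "(\<integral>\<^sup>+\<omega>. F (\<lambda>i. \<xi> i \<omega>) * ennreal (cosh (a * (X (\<lambda>i. \<xi> i \<omega>) + \<xi> k \<omega>))) \<partial>M)
    = ennreal (exp (a\<^sup>2 * \<delta> / 2)) * (\<integral>\<^sup>+\<omega>. F (\<lambda>i. \<xi> i \<omega>) * ennreal (cosh (a * X (\<lambda>i. \<xi> i \<omega>))) \<partial>M)"
proof -
  let ?F = "\<lambda>\<omega>. F (\<lambda>i. \<xi> i \<omega>)" and ?X = "\<lambda>\<omega>. X (\<lambda>i. \<xi> i \<omega>)"
  let ?E = "\<lambda>b \<omega>. ?F \<omega> * ennreal (exp (b * ?X \<omega>) / 2)"
  have mF [measurable]: "?F \<in> borel_measurable M" by (rule past_random_variable[OF F])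
  have mX [measurable]: "?X \<in> borel_measurable M" by (rule past_random_variable[OF X])
  have half: "(\<integral>\<^sup>+\<omega>. ?E b \<omega> * ennreal (exp (b * \<xi> k \<omega>)) \<partial>M) = (\<integral>\<^sup>+\<omega>. ?E b \<omega> \<partial>M) * ennreal (exp (b\<^sup>2 * \<delta> / 2))" for b
    unfolding nn_integral_exp_step[of b k, symmetric]
    using F X by (intro nn_integral_past_times_next[where F="\<lambda>x. F x * ennreal (exp (b * X x) / 2)"]) auto
  have add: "ennreal (cosh (a * (x + z)))
      = ennreal (exp (a * x) / 2) * ennreal (exp (a * z)) + ennreal (exp (-a * x) / 2) * ennreal (exp (-a * z))" for x z
  proof -
    have "cosh (a * (x + z)) = exp (a * x) / 2 * exp (a * z) + exp (-a * x) / 2 * exp (-a * z)"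
      by (simp add: cosh_field_def distrib_left add_divide_distrib flip: exp_add)
    then show ?thesis by (simp flip: ennreal_mult ennreal_plus)
  qed
  have "(\<integral>\<^sup>+\<omega>. ?F \<omega> * ennreal (cosh (a * (?X \<omega> + \<xi> k \<omega>))) \<partial>M)
      = (\<integral>\<^sup>+\<omega>. ?E a \<omega> * ennreal (exp (a * \<xi> k \<omega>)) + ?E (-a) \<omega> * ennreal (exp (-a * \<xi> k \<omega>)) \<partial>M)"
    unfolding add by (simp only: distrib_left mult.assoc)
  also have "\<dots> = ((\<integral>\<^sup>+\<omega>. ?E a \<omega> \<partial>M) + (\<integral>\<^sup>+\<omega>. ?E (-a) \<omega> \<partial>M)) * ennreal (exp (a\<^sup>2 * \<delta> / 2))"
    by (subst nn_integral_add) (simp_all only: half distrib_right power2_minus, measurable)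
  also have "(\<integral>\<^sup>+\<omega>. ?E a \<omega> \<partial>M) + (\<integral>\<^sup>+\<omega>. ?E (-a) \<omega> \<partial>M) = (\<integral>\<^sup>+\<omega>. ?E a \<omega> + ?E (-a) \<omega> \<partial>M)"
    by (subst nn_integral_add) auto
  also have "\<dots> = (\<integral>\<^sup>+\<omega>. ?F \<omega> * ennreal (cosh (a * ?X \<omega>)) \<partial>M)"
    using add[of _ 0] by (simp flip: distrib_left)
  finally show ?thesis by (simp add: mult.commute)
qed

lemma nn_integral_cosh_step:
  "(\<integral>\<^sup>+\<omega>. ennreal (cosh (a * \<xi> k \<omega>)) \<partial>M) = ennreal (exp (a\<^sup>2 * \<delta> / 2))"
  using nn_integral_cosh_martingale[of "\<lambda>_. 1" k "\<lambda>_. 0" a] by (simp add: emeasure_space_1)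

end


section \<open>Discounted exit of a Gaussian walk from a symmetric interval\<close>

lemma borel_measurable_cosh [measurable (raw)]:
  "f \<in> borel_measurable N \<Longrightarrow> (\<lambda>x. cosh (f x :: real)) \<in> borel_measurable N"
  by (rule measurable_compose[OF _ borel_measurable_continuous_onI[OF continuous_on_cosh[OF continuous_on_id]]])

definition walk :: "(nat \<Rightarrow> real) \<Rightarrow> nat \<Rightarrow> real" where
  "walk x k = (\<Sum>i<k. x i)"

definition stays_inside :: "real \<Rightarrow> (nat \<Rightarrow> real) \<Rightarrow> nat \<Rightarrow> bool" where
  "stays_inside c x k \<longleftrightarrow> (\<forall>j\<le>k. \<bar>walk x j\<bar> < c)"

definition exits_next :: "real \<Rightarrow> (nat \<Rightarrow> real) \<Rightarrow> nat \<Rightarrow> bool" where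
  "exits_next c x k \<longleftrightarrow> stays_inside c x k \<and> c \<le> \<bar>walk x (Suc k)\<bar>"

text \<open>The value is \<open>exp (- \<mu> T)\<close> if the first exit time \<open>T\<close> of the walk from \<open>(-c, c)\<close> on the grid of mesh \<open>\<delta>\<close> falls
within the first \<open>m\<close> steps, and 0 otherwise: at most one summand differs from 0.\<close>
definition discounted_exit :: "real \<Rightarrow> real \<Rightarrow> real \<Rightarrow> nat \<Rightarrow> (nat \<Rightarrow> real) \<Rightarrow> real" where
  "discounted_exit \<mu> c \<delta> m x = (\<Sum>k<m. of_bool (exits_next c x k) * exp (- \<mu> * (\<delta> * Suc k)))"

lemma walk_Suc: "walk x (Suc k) = walk x k + x k"
  by (simp add: walk_def)

lemma walk_restrict: "j \<le> k \<Longrightarrow> walk (restrict x {..<k}) j = walk x j"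
  by (auto simp: walk_def intro!: sum.cong)

lemma stays_inside_restrict: "stays_inside c (restrict x {..<k}) k = stays_inside c x k"
  by (simp add: stays_inside_def walk_restrict)

lemma walk_measurable: "j \<le> k \<Longrightarrow> (\<lambda>x. walk x j) \<in> borel_measurable (PiM {..<k} (\<lambda>_. borel))"
  unfolding walk_def by (intro borel_measurable_sum measurable_component_singleton) auto

lemma stays_inside_iff: "stays_inside c x k \<longleftrightarrow> (\<forall>j\<in>{..k}. \<bar>walk x j\<bar> < c)"
  by (auto simp: stays_inside_def)

lemma stays_inside_measurable: "Measurable.pred (PiM {..<k} (\<lambda>_. borel)) (\<lambda>x. stays_inside c x k)"
proof -
  have *: "Measurable.pred (PiM {..<k} (\<lambda>_. borel)) (\<lambda>x. \<bar>walk x j\<bar> < c)" if "j \<in> {..k}" for j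
  proof -
    have [measurable]: "(\<lambda>x. walk x j) \<in> borel_measurable (PiM {..<k} (\<lambda>_. borel))"
      using that by (intro walk_measurable) simp
    show ?thesis by measurable
  qed
  show ?thesis
    unfolding stays_inside_iff by (rule pred_intros_finite(3)[OF finite_atMost *])
qed

lemma cosh_abs_mono: "\<bar>x\<bar> \<le> \<bar>y\<bar> \<Longrightarrow> cosh x \<le> cosh (y :: real)"
  by (metis abs_ge_zero cosh_real_abs cosh_real_nonneg_le_iff)

context gaussian_walk
begin

abbreviation S :: "nat \<Rightarrow> 'a \<Rightarrow> real" where "S k \<omega> \<equiv> walk (\<lambda>i. \<xi> i \<omega>) k"

lemma S_measurable [measurable]: "S k \<in> borel_measurable M"
  by (rule past_random_variable[OF walk_measurable[OF order_refl] walk_restrict[OF order_refl]])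

lemma stays_inside_pred [measurable]: "Measurable.pred M (\<lambda>\<omega>. stays_inside c (\<lambda>i. \<xi> i \<omega>) k)"
  unfolding stays_inside_iff by (rule pred_intros_finite(3)) auto

lemma exits_next_pred [measurable]: "Measurable.pred M (\<lambda>\<omega>. exits_next c (\<lambda>i. \<xi> i \<omega>) k)"
  unfolding exits_next_def by measurable

lemma discounted_exit_measurable [measurable]:
  "(\<lambda>\<omega>. discounted_exit \<mu> c \<delta>' m (\<lambda>i. \<xi> i \<omega>)) \<in> borel_measurable M"
  unfolding discounted_exit_def by (intro borel_measurable_sum) measurable

definition surviving_mass :: "real \<Rightarrow> real \<Rightarrow> nat \<Rightarrow> ennreal" where
  "surviving_mass a c k = (\<integral>\<^sup>+\<omega>. ennreal (of_bool (stays_inside c (\<lambda>i. \<xi> i \<omega>) k) * exp (- (a\<^sup>2 / 2) * (\<delta> * k)) * cosh (a * S k \<omega>)) \<partial>M)"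

definition exit_mass :: "real \<Rightarrow> real \<Rightarrow> nat \<Rightarrow> ennreal" where
  "exit_mass a c k = (\<integral>\<^sup>+\<omega>. ennreal (of_bool (exits_next c (\<lambda>i. \<xi> i \<omega>) k) * exp (- (a\<^sup>2 / 2) * (\<delta> * Suc k)) * cosh (a * S (Suc k) \<omega>)) \<partial>M)"

lemma mass_step: "surviving_mass a c (Suc k) + exit_mass a c k = surviving_mass a c k"
proof -
  let ?in = "\<lambda>k \<omega>. stays_inside c (\<lambda>i. \<xi> i \<omega>) k" and ?e = "exp (- (a\<^sup>2 / 2) * (\<delta> * Suc k))"
  have split: "of_bool (?in (Suc k) \<omega>) + of_bool (exits_next c (\<lambda>i. \<xi> i \<omega>) k) = (of_bool (?in k \<omega>) :: real)" for \<omega>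
    by (auto simp: exits_next_def stays_inside_def le_Suc_eq not_less)
  have "of_bool (?in (Suc k) \<omega>) * ?e * cosh (a * S (Suc k) \<omega>)
      + of_bool (exits_next c (\<lambda>i. \<xi> i \<omega>) k) * ?e * cosh (a * S (Suc k) \<omega>)
      = (of_bool (?in k \<omega>) * ?e) * cosh (a * (S k \<omega> + \<xi> k \<omega>))" for \<omega>
    unfolding distrib_right[symmetric] split walk_Suc ..
  then have "surviving_mass a c (Suc k) + exit_mass a c k
    = (\<integral>\<^sup>+\<omega>. ennreal (of_bool (?in k \<omega>) * ?e) * ennreal (cosh (a * (S k \<omega> + \<xi> k \<omega>))) \<partial>M)"
    unfolding surviving_mass_def exit_mass_def
    by (subst nn_integral_add[symmetric]) (auto simp flip: ennreal_mult ennreal_plus)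
  also have "\<dots> = ennreal (exp (a\<^sup>2 * \<delta> / 2)) *
      (\<integral>\<^sup>+\<omega>. ennreal (of_bool (?in k \<omega>) * exp (- (a\<^sup>2 / 2) * (\<delta> * Suc k))) * ennreal (cosh (a * S k \<omega>)) \<partial>M)"
    using stays_inside_measurable[of c k]
    by (intro nn_integral_cosh_martingale[where X="\<lambda>x. walk x k" and
            F="\<lambda>x. ennreal (of_bool (stays_inside c x k) * ?e)"] walk_measurable)
       (simp_all add: walk_restrict stays_inside_restrict)
  also have "\<dots> = surviving_mass a c k"
    unfolding surviving_mass_def
    by (subst nn_integral_cmult[symmetric])
       (auto intro!: nn_integral_cong simp: algebra_simps simp flip: ennreal_mult exp_add)
  finally show ?thesis .
qed

text \<open>Optional stopping for the \<open>cosh\<close> martingale, in the form of a conservation law: the mass 1 present at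
time 0 is either still inside after \<open>m\<close> steps or has left at one of them.\<close>
lemma mass_balance: "0 < c \<Longrightarrow> surviving_mass a c m + (\<Sum>k<m. exit_mass a c k) = 1"
proof (induction m)
  case 0
  then show ?case by (simp add: surviving_mass_def stays_inside_def walk_def emeasure_space_1)
next
  case (Suc m)
  have "surviving_mass a c (Suc m) + (\<Sum>k<Suc m. exit_mass a c k)
      = (surviving_mass a c (Suc m) + exit_mass a c m) + (\<Sum>k<m. exit_mass a c k)"
    by (simp add: ac_simps)
  then show ?case using Suc by (simp only: mass_step)
qed

lemma nn_integral_discounted_exit:
  "(\<integral>\<^sup>+\<omega>. ennreal (discounted_exit \<mu> c \<delta> m (\<lambda>i. \<xi> i \<omega>)) \<partial>M)
    = (\<Sum>k<m. \<integral>\<^sup>+\<omega>. ennreal (of_bool (exits_next c (\<lambda>i. \<xi> i \<omega>) k) * exp (- \<mu> * (\<delta> * Suc k))) \<partial>M)"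
proof -
  have "ennreal (discounted_exit \<mu> c \<delta> m x)
      = (\<Sum>k<m. ennreal (of_bool (exits_next c x k) * exp (- \<mu> * (\<delta> * Suc k))))" for x
    unfolding discounted_exit_def by (rule sum_ennreal[symmetric]) simp
  then show ?thesis by (simp only:) (intro nn_integral_sum, measurable)
qed

text \<open>The walk leaves with \<open>\<bar>S\<bar> \<ge> c\<close>, so the mass leaving at step \<open>k\<close> is at least \<open>cosh (a c)\<close> times the
discounted probability of leaving then.\<close>
lemma discounted_exit_le:
  assumes "0 < c"
  shows "(\<integral>\<^sup>+\<omega>. ennreal (discounted_exit (a\<^sup>2 / 2) c \<delta> m (\<lambda>i. \<xi> i \<omega>)) \<partial>M) \<le> ennreal (1 / cosh (a * c))"
proof -
  let ?D = "\<integral>\<^sup>+\<omega>. ennreal (discounted_exit (a\<^sup>2 / 2) c \<delta> m (\<lambda>i. \<xi> i \<omega>)) \<partial>M"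
  have "ennreal (cosh (a * c)) * ?D \<le> (\<Sum>k<m. exit_mass a c k)"
    unfolding nn_integral_discounted_exit sum_distrib_left
  proof (rule sum_mono)
    fix k
    show "ennreal (cosh (a * c)) * (\<integral>\<^sup>+\<omega>. ennreal (of_bool (exits_next c (\<lambda>i. \<xi> i \<omega>) k) * exp (- (a\<^sup>2 / 2) * (\<delta> * Suc k))) \<partial>M)
        \<le> exit_mass a c k"
      unfolding exit_mass_def
    proof (subst nn_integral_cmult[symmetric])
      show "(\<lambda>\<omega>. ennreal (of_bool (exits_next c (\<lambda>i. \<xi> i \<omega>) k) * exp (- (a\<^sup>2 / 2) * (\<delta> * Suc k)))) \<in> borel_measurable M"
        by measurable
    next
      have "cosh (a * c) \<le> cosh (a * S (Suc k) \<omega>)" if "exits_next c (\<lambda>i. \<xi> i \<omega>) k" for \<omega>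
        using that assms by (intro cosh_abs_mono) (auto simp: exits_next_def abs_mult intro!: mult_left_mono)
      then have "ennreal (cosh (a * c)) * ennreal (of_bool (exits_next c (\<lambda>i. \<xi> i \<omega>) k) * exp (- (a\<^sup>2 / 2) * (\<delta> * Suc k)))
          \<le> ennreal (of_bool (exits_next c (\<lambda>i. \<xi> i \<omega>) k) * exp (- (a\<^sup>2 / 2) * (\<delta> * Suc k)) * cosh (a * S (Suc k) \<omega>))"
        for \<omega>
        by (auto simp: ennreal_mult[symmetric] mult.commute[of "cosh (a * c)"])
      then show "(\<integral>\<^sup>+\<omega>. ennreal (cosh (a * c)) * ennreal (of_bool (exits_next c (\<lambda>i. \<xi> i \<omega>) k) * exp (- (a\<^sup>2 / 2) * (\<delta> * Suc k))) \<partial>M)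
          \<le> (\<integral>\<^sup>+\<omega>. ennreal (of_bool (exits_next c (\<lambda>i. \<xi> i \<omega>) k) * exp (- (a\<^sup>2 / 2) * (\<delta> * Suc k)) * cosh (a * S (Suc k) \<omega>)) \<partial>M)"
        by (intro nn_integral_mono)
    qed
  qed
  also have "\<dots> \<le> 1"
    using mass_balance[OF assms, of a m] by (metis add.commute le_iff_add)
  finally have "ennreal (1 / cosh (a * c)) * (ennreal (cosh (a * c)) * ?D) \<le> ennreal (1 / cosh (a * c)) * 1"
    by (rule mult_left_mono) simp
  moreover have "ennreal (1 / cosh (a * c)) * ennreal (cosh (a * c)) = 1"
    by (simp flip: ennreal_mult)
  ultimately show ?thesis by (simp flip: mult.assoc)
qed

end


lemma exits_next_unique: "exits_next c x k \<Longrightarrow> exits_next c x l \<Longrightarrow> k = l"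
proof (rule ccontr)
  assume "exits_next c x k" "exits_next c x l" "k \<noteq> l"
  then show False
    unfolding exits_next_def stays_inside_def by (metis Suc_leI linorder_neqE_nat not_less)
qed

lemma discounted_exit_cases:
  obtains "discounted_exit \<mu> c \<delta> m x = 0"
  | k where "k < m" "exits_next c x k" "discounted_exit \<mu> c \<delta> m x = exp (- \<mu> * (\<delta> * Suc k))"
proof (cases "\<exists>k<m. exits_next c x k")
  case True
  then obtain k where k: "k < m" "exits_next c x k" by blast
  have ex: "exits_next c x l \<longleftrightarrow> l = k" for l
    using k(2) exits_next_unique by blast
  have "discounted_exit \<mu> c \<delta> m x = (\<Sum>l<m. if l = k then exp (- \<mu> * (\<delta> * Suc k)) else 0)"
    unfolding discounted_exit_def ex by (intro sum.cong) auto
  also have "\<dots> = exp (- \<mu> * (\<delta> * Suc k))" using k by simp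
  finally show ?thesis using k that by blast
next
  case False
  then have "discounted_exit \<mu> c \<delta> m x = 0" unfolding discounted_exit_def by (intro sum.neutral) auto
  then show ?thesis using that by blast
qed

lemma exp_le_discounted_exit:
  assumes "0 < c" "c \<le> \<bar>walk x j\<bar>" "j \<le> m" "0 \<le> \<mu>" "0 \<le> \<delta>"
  shows "exp (- \<mu> * (\<delta> * j)) \<le> discounted_exit \<mu> c \<delta> m x"
proof -
  define i where "i = (LEAST i. c \<le> \<bar>walk x i\<bar>)"
  have least: "\<bar>walk x l\<bar> < c" if "l < i" for l
    using not_less_Least[of l] that unfolding i_def by (metis not_le)
  have i: "c \<le> \<bar>walk x i\<bar>" "i \<le> j"
    unfolding i_def by (rule LeastI[of _ j], fact) (rule Least_le, fact)
  have "i \<noteq> 0" using i(1) assms(1) by (auto simp: walk_def intro: ccontr)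
  then obtain k where k: "i = Suc k" using not0_implies_Suc by blast
  have ex: "exits_next c x k"
    using i(1) least by (auto simp: exits_next_def stays_inside_def k)
  have "exp (- \<mu> * (\<delta> * j)) \<le> exp (- \<mu> * (\<delta> * Suc k))"
    using i(2) assms(4,5) unfolding k by (auto intro!: mult_left_mono)
  also have "\<dots> \<le> discounted_exit \<mu> c \<delta> m x"
  proof (cases rule: discounted_exit_cases[of \<mu> c \<delta> m x])
    case 1
    have "k < m" using i(2) assms(3) k by simp
    then have "exp (- \<mu> * (\<delta> * Suc k)) \<le> discounted_exit \<mu> c \<delta> m x"
      unfolding discounted_exit_def
      using ex by (intro order_trans[OF _ member_le_sum[of k]]) auto
    then show ?thesis .
  next
    case (2 l)
    then show ?thesis using exits_next_unique[OF ex] by simp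
  qed
  finally show ?thesis .
qed

lemma cosh_le_exp: "0 \<le> x \<Longrightarrow> cosh x \<le> exp (x :: real)"
  by (simp add: cosh_field_def)

lemma exp_abs_le_cosh: "exp \<bar>x\<bar> \<le> 2 * cosh (x :: real)"
  by (auto simp: cosh_field_def abs_if)

context gaussian_walk
begin

definition overshoot_error :: "real \<Rightarrow> real \<Rightarrow> real \<Rightarrow> real" where
  "overshoot_error a c \<eta> = 2 * exp (a * c - \<eta> / sqrt \<delta> + (a + 1 / sqrt \<delta>)\<^sup>2 * \<delta> / 2)"

text \<open>A step larger than \<open>\<eta>\<close> is so unlikely that its contribution vanishes even after multiplication with
the number of steps: an extra exponential weight of rate \<open>1 / sqrt \<delta>\<close> costs a bounded factor and gains
\<open>exp (- \<eta> / sqrt \<delta>)\<close>.\<close>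
lemma large_step_bound:
  assumes "0 \<le> a" "0 \<le> c"
  shows "(\<integral>\<^sup>+\<omega>. ennreal (of_bool (\<eta> < \<bar>\<xi> k \<omega>\<bar>) * cosh (a * (c + \<bar>\<xi> k \<omega>\<bar>))) \<partial>M) \<le> ennreal (overshoot_error a c \<eta>)"
proof -
  define b where "b = 1 / sqrt \<delta>"
  have b: "0 < b" unfolding b_def using step_pos by simp
  have pt: "of_bool (\<eta> < \<bar>z\<bar>) * cosh (a * (c + \<bar>z\<bar>)) \<le> 2 * exp (a * c - \<eta> * b) * cosh ((a + b) * z)" for z
  proof (cases "\<eta> < \<bar>z\<bar>")
    case True
    have "cosh (a * (c + \<bar>z\<bar>)) \<le> exp (a * (c + \<bar>z\<bar>))"
      using assms by (intro cosh_le_exp) simp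
    also have "\<dots> \<le> exp (a * c - \<eta> * b) * exp ((a + b) * \<bar>z\<bar>)"
      using True b unfolding exp_add[symmetric] by (simp add: algebra_simps)
    also have "exp ((a + b) * \<bar>z\<bar>) \<le> 2 * cosh ((a + b) * z)"
      using exp_abs_le_cosh[of "(a + b) * z"] assms b by (simp add: abs_mult)
    finally show ?thesis using True by (simp add: mult_left_mono ac_simps)
  qed simp
  have "(\<integral>\<^sup>+\<omega>. ennreal (of_bool (\<eta> < \<bar>\<xi> k \<omega>\<bar>) * cosh (a * (c + \<bar>\<xi> k \<omega>\<bar>))) \<partial>M)
    \<le> (\<integral>\<^sup>+\<omega>. ennreal (2 * exp (a * c - \<eta> * b)) * ennreal (cosh ((a + b) * \<xi> k \<omega>)) \<partial>M)"
    by (intro nn_integral_mono) (simp add: pt flip: ennreal_mult)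
  also have "\<dots> = ennreal (2 * exp (a * c - \<eta> * b)) * ennreal (exp ((a + b)\<^sup>2 * \<delta> / 2))"
    by (subst nn_integral_cmult) (auto simp: nn_integral_cosh_step)
  also have "\<dots> = ennreal (overshoot_error a c \<eta>)"
    unfolding overshoot_error_def b_def by (simp flip: ennreal_mult add: exp_add)
  finally show ?thesis .
qed

lemma exit_mass_le:
  assumes a: "0 \<le> a" and c: "0 \<le> c"
  shows "exit_mass a c k \<le> ennreal (cosh (a * (c + \<eta>))) *
      (\<integral>\<^sup>+\<omega>. ennreal (of_bool (exits_next c (\<lambda>i. \<xi> i \<omega>) k) * exp (- (a\<^sup>2 / 2) * (\<delta> * Suc k))) \<partial>M)
      + ennreal (overshoot_error a c \<eta>)"
proof -
  let ?e = "exp (- (a\<^sup>2 / 2) * (\<delta> * Suc k))" and ?x = "\<lambda>\<omega> i. \<xi> i \<omega>"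
  have e: "?e \<le> 1" using step_pos by simp
  have pt: "of_bool (exits_next c (?x \<omega>) k) * ?e * cosh (a * S (Suc k) \<omega>)
      \<le> cosh (a * (c + \<eta>)) * (of_bool (exits_next c (?x \<omega>) k) * ?e)
        + of_bool (\<eta> < \<bar>\<xi> k \<omega>\<bar>) * cosh (a * (c + \<bar>\<xi> k \<omega>\<bar>))" for \<omega>
  proof (cases "exits_next c (?x \<omega>) k")
    case True
    then have "\<bar>S k \<omega>\<bar> < c" by (simp add: exits_next_def stays_inside_def)
    then have S: "\<bar>S (Suc k) \<omega>\<bar> \<le> c + \<bar>\<xi> k \<omega>\<bar>" by (simp add: walk_Suc)
    have mono: "cosh (a * S (Suc k) \<omega>) \<le> cosh (a * d)" if "\<bar>S (Suc k) \<omega>\<bar> \<le> d" for d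
      using that a by (intro cosh_abs_mono) (auto simp: abs_mult intro!: mult_left_mono)
    show ?thesis
    proof (cases "\<eta> < \<bar>\<xi> k \<omega>\<bar>")
      case True
      have "?e * cosh (a * S (Suc k) \<omega>) \<le> 1 * cosh (a * (c + \<bar>\<xi> k \<omega>\<bar>))"
        using e mono[OF S] by (intro mult_mono) auto
      then show ?thesis using True by (auto intro: order_trans add_increasing)
    next
      case False
      then have "cosh (a * S (Suc k) \<omega>) \<le> cosh (a * (c + \<eta>))"
        using S by (intro mono) auto
      then show ?thesis using False by (auto simp: mult.commute)
    qed
  qed simp
  have "exit_mass a c k \<le> (\<integral>\<^sup>+\<omega>. ennreal (cosh (a * (c + \<eta>))) * ennreal (of_bool (exits_next c (?x \<omega>) k) * ?e)
        + ennreal (of_bool (\<eta> < \<bar>\<xi> k \<omega>\<bar>) * cosh (a * (c + \<bar>\<xi> k \<omega>\<bar>))) \<partial>M)"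
    unfolding exit_mass_def
    by (intro nn_integral_mono, subst ennreal_mult[symmetric], simp, simp,
        subst ennreal_plus[symmetric], simp, simp, intro ennreal_leI pt)
  also have "\<dots> = ennreal (cosh (a * (c + \<eta>))) * (\<integral>\<^sup>+\<omega>. ennreal (of_bool (exits_next c (?x \<omega>) k) * ?e) \<partial>M)
        + (\<integral>\<^sup>+\<omega>. ennreal (of_bool (\<eta> < \<bar>\<xi> k \<omega>\<bar>) * cosh (a * (c + \<bar>\<xi> k \<omega>\<bar>))) \<partial>M)"
    by (subst nn_integral_add) (auto simp: nn_integral_cmult)
  also have "\<dots> \<le> ennreal (cosh (a * (c + \<eta>))) * (\<integral>\<^sup>+\<omega>. ennreal (of_bool (exits_next c (?x \<omega>) k) * ?e) \<partial>M)
      + ennreal (overshoot_error a c \<eta>)"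
    by (intro add_left_mono large_step_bound assms)
  finally show ?thesis .
qed

lemma surviving_mass_le:
  "surviving_mass a c m \<le> ennreal (exp (- (a\<^sup>2 / 2) * (\<delta> * m)) * cosh (a * c))"
proof -
  have "cosh (a * S m \<omega>) \<le> cosh (a * c)" if "stays_inside c (\<lambda>i. \<xi> i \<omega>) m" for \<omega>
  proof -
    have "\<bar>S m \<omega>\<bar> < c" using that by (simp add: stays_inside_def)
    then have "\<bar>S m \<omega>\<bar> \<le> \<bar>c\<bar>" by simp
    then show ?thesis by (intro cosh_abs_mono) (simp add: abs_mult mult_left_mono)
  qed
  then have "surviving_mass a c m \<le> (\<integral>\<^sup>+\<omega>. ennreal (exp (- (a\<^sup>2 / 2) * (\<delta> * m)) * cosh (a * c)) \<partial>M)"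
    unfolding surviving_mass_def by (intro nn_integral_mono) auto
  then show ?thesis by (simp add: emeasure_space_1)
qed

text \<open>The converse of \<open>discounted_exit_le\<close>. Leaving by a step of size at most \<open>\<eta>\<close> means leaving with
\<open>\<bar>S\<bar> \<le> c + \<eta>\<close>; what remains is the mass still inside, which the discount makes small for long
horizons, and the overshoot by large steps.\<close>
lemma one_le_discounted_exit:
  assumes a: "0 \<le> a" and c: "0 < c"
  shows "1 \<le> ennreal (exp (- (a\<^sup>2 / 2) * (\<delta> * m)) * cosh (a * c))
    + ennreal (cosh (a * (c + \<eta>))) * (\<integral>\<^sup>+\<omega>. ennreal (discounted_exit (a\<^sup>2 / 2) c \<delta> m (\<lambda>i. \<xi> i \<omega>)) \<partial>M)
    + ennreal (m * overshoot_error a c \<eta>)"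
proof -
  have "(\<Sum>k<m. exit_mass a c k) \<le> (\<Sum>k<m. ennreal (cosh (a * (c + \<eta>))) *
      (\<integral>\<^sup>+\<omega>. ennreal (of_bool (exits_next c (\<lambda>i. \<xi> i \<omega>) k) * exp (- (a\<^sup>2 / 2) * (\<delta> * Suc k))) \<partial>M)
      + ennreal (overshoot_error a c \<eta>))"
    using c by (intro sum_mono exit_mass_le[OF a]) simp
  also have "\<dots> = ennreal (cosh (a * (c + \<eta>))) * (\<integral>\<^sup>+\<omega>. ennreal (discounted_exit (a\<^sup>2 / 2) c \<delta> m (\<lambda>i. \<xi> i \<omega>)) \<partial>M)
    + ennreal (m * overshoot_error a c \<eta>)"
    unfolding nn_integral_discounted_exit sum.distrib sum_distrib_left
    by (simp add: ennreal_mult' ennreal_of_nat_eq_real_of_nat)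
  finally have "surviving_mass a c m + (\<Sum>k<m. exit_mass a c k) \<le> ennreal (exp (- (a\<^sup>2 / 2) * (\<delta> * m)) * cosh (a * c)) +
     (ennreal (cosh (a * (c + \<eta>))) * (\<integral>\<^sup>+\<omega>. ennreal (discounted_exit (a\<^sup>2 / 2) c \<delta> m (\<lambda>i. \<xi> i \<omega>)) \<partial>M)
    + ennreal (m * overshoot_error a c \<eta>))"
    by (rule add_mono[OF surviving_mass_le])
  then show ?thesis by (simp only: mass_balance[OF c] add.assoc)
qed

end


section \<open>The exit time of a path and its discretisation\<close>

definition increments :: "(real \<Rightarrow> 'a \<Rightarrow> real) \<Rightarrow> real \<Rightarrow> nat \<Rightarrow> 'a \<Rightarrow> real" where
  "increments W \<delta> k \<omega> = W (\<delta> * Suc k) \<omega> - W (\<delta> * k) \<omega>"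

lemma walk_increments: "walk (\<lambda>i. increments W \<delta> i \<omega>) j = W (\<delta> * j) \<omega> - W 0 \<omega>"
  unfolding walk_def increments_def by (subst sum_lessThan_telescope) simp

lemma wiener_gaussian_walk:
  assumes W: "wiener_process M W" and "0 < \<delta>"
  shows "gaussian_walk M (increments W \<delta>) \<delta>"
proof -
  interpret prob_space M using W by (simp add: wiener_process_def)
  show ?thesis
  proof
    fix n
    have "\<forall>(n::nat) (t::nat \<Rightarrow> real). 0 \<le> t 0 \<and> (\<forall>i<n. t i \<le> t (Suc i)) \<longrightarrow>
        indep_vars (\<lambda>_. borel) (\<lambda>i \<omega>. W (t (Suc i)) \<omega> - W (t i) \<omega>) {..<n}"
      using W by (simp add: wiener_process_def)
    from this[rule_format, of "\<lambda>k. \<delta> * k" n]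
    show "indep_vars (\<lambda>_. borel) (increments W \<delta>) {..<n}"
      using assms(2) unfolding increments_def[abs_def] by simp
  next
    fix k
    have "\<forall>s t. 0 \<le> s \<and> s < t \<longrightarrow>
        distributed M lborel (\<lambda>\<omega>. W t \<omega> - W s \<omega>) (\<lambda>x. ennreal (normal_density 0 (sqrt (t - s)) x))"
      using W by (simp add: wiener_process_def)
    from this[rule_format, of "\<delta> * k" "\<delta> * Suc k"]
    show "distributed M lborel (increments W \<delta> k) (\<lambda>x. ennreal (normal_density 0 (sqrt \<delta>) x))"
      using assms(2) unfolding increments_def[abs_def] by (simp add: algebra_simps)
  qed (use assms(2) in simp)
qed

text \<open>By the intermediate value theorem, reaching modulus at least 1 forces modulus exactly 1 earlier. In the
other direction, a path that is below 1 on \<open>[0, t]\<close> stays below 1 a little longer, so the infimum is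
larger than \<open>t\<close>.\<close>
lemma exit_time_le_iff:
  assumes cont: "continuous_on {0..} (\<lambda>t. W t \<omega>)" and W0: "W 0 \<omega> = 0" and t: "0 \<le> t"
  shows "exit_time W \<omega> \<le> ennreal t \<longleftrightarrow> (\<exists>s\<in>{0..t}. 1 \<le> \<bar>W s \<omega>\<bar>)"
proof
  assume "\<exists>s\<in>{0..t}. 1 \<le> \<bar>W s \<omega>\<bar>"
  then obtain s where s: "0 \<le> s" "s \<le> t" "1 \<le> \<bar>W s \<omega>\<bar>" by auto
  have "continuous_on {0..s} (\<lambda>t. \<bar>W t \<omega>\<bar>)"
    by (intro continuous_intros continuous_on_subset[OF cont]) auto
  then obtain r where r: "0 \<le> r" "r \<le> s" "\<bar>W r \<omega>\<bar> = 1"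
    using IVT'[of "\<lambda>t. \<bar>W t \<omega>\<bar>" 0 1 s] s W0 by auto
  then have "0 < r" using W0 by (cases "r = 0") auto
  then have "exit_time W \<omega> \<le> ennreal r"
    unfolding exit_time_def using r by (intro Inf_lower) auto
  also have "\<dots> \<le> ennreal t" using r s by (intro ennreal_leI) auto
  finally show "exit_time W \<omega> \<le> ennreal t" .
next
  assume le: "exit_time W \<omega> \<le> ennreal t"
  show "\<exists>s\<in>{0..t}. 1 \<le> \<bar>W s \<omega>\<bar>"
  proof (rule ccontr)
    assume "\<not> ?thesis"
    then have small: "\<bar>W s \<omega>\<bar> < 1" if "0 \<le> s" "s \<le> t" for s using that by force
    have "0 < 1 - \<bar>W t \<omega>\<bar>" using small[of t] t by simp
    moreover have "continuous_on {0..} (\<lambda>t. \<bar>W t \<omega>\<bar>)" by (intro continuous_intros cont)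
    ultimately obtain d where d: "0 < d"
      "\<And>s. 0 \<le> s \<Longrightarrow> dist s t < d \<Longrightarrow> dist \<bar>W s \<omega>\<bar> \<bar>W t \<omega>\<bar> < 1 - \<bar>W t \<omega>\<bar>"
      using t unfolding continuous_on_iff by (metis atLeast_iff)
    have "ennreal (t + d) \<le> exit_time W \<omega>"
      unfolding exit_time_def
    proof (rule Inf_greatest)
      fix u assume "u \<in> {ennreal t |t. 0 < t \<and> \<bar>W t \<omega>\<bar> = 1}"
      then obtain s where s: "u = ennreal s" "0 < s" "\<bar>W s \<omega>\<bar> = 1" by blast
      have "t + d \<le> s"
      proof (rule ccontr)
        assume "\<not> t + d \<le> s"
        then have "s \<le> t \<or> dist s t < d" by (auto simp: dist_real_def)
        then show False using small[of s] d(2)[of s] s by (auto simp: dist_real_def)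
      qed
      then show "ennreal (t + d) \<le> u" unfolding s(1) by (rule ennreal_leI)
    qed
    also note le
    finally show False using d(1) t by (simp add: ennreal_le_iff)
  qed
qed

text \<open>Only countably many times enter on the right hand side; this makes the exit time measurable off a
null set.\<close>
lemma exit_time_le_iff_rational:
  assumes cont: "continuous_on {0..} (\<lambda>t. W t \<omega>)" and W0: "W 0 \<omega> = 0" and t: "0 < t"
  shows "exit_time W \<omega> \<le> ennreal t \<longleftrightarrow> (\<forall>j::nat. \<exists>q\<in>\<rat> \<inter> {0..t}. 1 - 1 / Suc j < \<bar>W q \<omega>\<bar>)"
proof -
  have cont_abs: "continuous_on {0..t} (\<lambda>t. \<bar>W t \<omega>\<bar>)"
    by (intro continuous_intros continuous_on_subset[OF cont]) auto
  show ?thesis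
    unfolding exit_time_le_iff[of W \<omega> t, OF cont W0 less_imp_le[OF t]]
  proof
    assume "\<exists>s\<in>{0..t}. 1 \<le> \<bar>W s \<omega>\<bar>"
    then obtain s where s: "s \<in> {0..t}" "1 \<le> \<bar>W s \<omega>\<bar>" by blast
    show "\<forall>j::nat. \<exists>q\<in>\<rat> \<inter> {0..t}. 1 - 1 / Suc j < \<bar>W q \<omega>\<bar>"
    proof
      fix j :: nat
      obtain d where d: "0 < d" "\<And>q. q \<in> {0..t} \<Longrightarrow> dist q s < d \<Longrightarrow> dist \<bar>W q \<omega>\<bar> \<bar>W s \<omega>\<bar> < 1 / Suc j"
        using cont_abs s(1) unfolding continuous_on_iff by (metis of_nat_0_less_iff zero_less_Suc zero_less_divide_1_iff)
      have "max 0 (s - d) < min t (s + d)" using s d(1) t by auto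
      then obtain q where q: "q \<in> \<rat>" "max 0 (s - d) < q" "q < min t (s + d)"
        using Rats_dense_in_real by blast
      have "dist \<bar>W q \<omega>\<bar> \<bar>W s \<omega>\<bar> < 1 / Suc j"
        using q by (intro d(2)) (auto simp: dist_real_def)
      then have "1 - 1 / Suc j < \<bar>W q \<omega>\<bar>" using s(2) unfolding dist_real_def by linarith
      then show "\<exists>q\<in>\<rat> \<inter> {0..t}. 1 - 1 / Suc j < \<bar>W q \<omega>\<bar>"
        using q by (intro bexI[of _ q]) auto
    qed
  next
    assume *: "\<forall>j::nat. \<exists>q\<in>\<rat> \<inter> {0..t}. 1 - 1 / Suc j < \<bar>W q \<omega>\<bar>"
    obtain s where s: "s \<in> {0..t}" "\<forall>r\<in>{0..t}. \<bar>W r \<omega>\<bar> \<le> \<bar>W s \<omega>\<bar>"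
      using continuous_attains_sup[OF compact_Icc _ cont_abs] t by fastforce
    have "1 - 1 / Suc j \<le> \<bar>W s \<omega>\<bar>" for j :: nat
      using *[rule_format, of j] s(2) by (auto intro: less_imp_le[OF less_le_trans])
    moreover have "(\<lambda>j. 1 - 1 / real (Suc j)) \<longlonglongrightarrow> 1" by real_asymp
    ultimately have "1 \<le> \<bar>W s \<omega>\<bar>"
      using LIMSEQ_le_const2 by blast
    then show "\<exists>s\<in>{0..t}. 1 \<le> \<bar>W s \<omega>\<bar>" using s(1) by blast
  qed
qed

definition discount :: "real \<Rightarrow> ennreal \<Rightarrow> real" where
  "discount \<mu> \<theta> = (if \<theta> = top then 0 else exp (- \<mu> * enn2real \<theta>))"

lemma discount_measurable [measurable]: "discount \<mu> \<in> borel_measurable borel"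
  unfolding discount_def[abs_def] by measurable

lemma discount_nonneg [simp]: "0 \<le> discount \<mu> \<theta>" and discount_le_1: "0 \<le> \<mu> \<Longrightarrow> discount \<mu> \<theta> \<le> 1"
  by (auto simp: discount_def)

lemma exp_le_discount:
  assumes "0 \<le> \<mu>" "0 \<le> t" "\<theta> \<le> ennreal t"
  shows "exp (- \<mu> * t) \<le> discount \<mu> \<theta>"
proof -
  have "enn2real \<theta> \<le> t" using assms by (simp add: enn2real_leI)
  moreover have "\<theta> \<noteq> top" using assms(3) by (auto simp: top_unique)
  ultimately show ?thesis using assms(1) by (simp add: discount_def mult_left_mono)
qed


lemma discounted_exit_nonneg: "0 \<le> discounted_exit \<mu> c \<delta> m x"
  unfolding discounted_exit_def by (intro sum_nonneg) simp

lemma discounted_exit_le_discount: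
  assumes cont: "continuous_on {0..} (\<lambda>t. W t \<omega>)" and W0: "W 0 \<omega> = 0" and "0 \<le> \<mu>" "0 < \<delta>"
  shows "discounted_exit \<mu> 1 \<delta> m (\<lambda>i. increments W \<delta> i \<omega>) \<le> discount \<mu> (exit_time W \<omega>)"
proof (cases rule: discounted_exit_cases[of \<mu> 1 \<delta> m "\<lambda>i. increments W \<delta> i \<omega>"])
  case 1
  then show ?thesis by simp
next
  case (2 k)
  have "1 \<le> \<bar>W (\<delta> * Suc k) \<omega>\<bar>"
    using 2(2) unfolding exits_next_def walk_increments W0 by simp
  then have "exit_time W \<omega> \<le> ennreal (\<delta> * Suc k)"
    using assms(4) by (subst exit_time_le_iff[of W \<omega>, OF cont W0]) (auto intro!: bexI[of _ "\<delta> * Suc k"])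
  then show ?thesis
    unfolding 2(3) using assms(3,4) by (intro exp_le_discount) auto
qed

text \<open>The level \<open>c < 1\<close> leaves room: the path exceeds \<open>c\<close> on a whole neighbourhood of a time at which its
modulus is at least 1, hence at a grid point before that time once the grid is fine. A walk watched for
the level 1 itself might notice the exit much too late. The horizon \<open>n\<close> grows with the grid so that
every finite exit time is eventually covered.\<close>
lemma eventually_discount_le_discounted_exit:
  assumes cont: "continuous_on {0..} (\<lambda>t. W t \<omega>)" and W0: "W 0 \<omega> = 0" and \<mu>: "0 \<le> \<mu>" and c: "0 < c" "c < 1"
  shows "\<forall>\<^sub>F n in sequentially. discount \<mu> (exit_time W \<omega>)
      \<le> discounted_exit \<mu> c (1 / Suc n) (Suc n * n) (\<lambda>i. increments W (1 / Suc n) i \<omega>)"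
proof (cases "exit_time W \<omega> = top")
  case True
  then show ?thesis by (simp add: discount_def discounted_exit_nonneg)
next
  case False
  then obtain t where t: "exit_time W \<omega> = ennreal t" "0 \<le> t" by (cases "exit_time W \<omega>") auto
  then obtain s where s: "0 \<le> s" "s \<le> t" "1 \<le> \<bar>W s \<omega>\<bar>"
    using exit_time_le_iff[of W \<omega> t, OF cont W0] by auto
  have "continuous_on {0..} (\<lambda>t. \<bar>W t \<omega>\<bar>)" by (intro continuous_intros cont)
  then obtain d where d: "0 < d" "\<And>q. 0 \<le> q \<Longrightarrow> dist q s < d \<Longrightarrow> dist \<bar>W q \<omega>\<bar> \<bar>W s \<omega>\<bar> < 1 - c"
    using s(1) c(2) unfolding continuous_on_iff by (metis atLeast_iff diff_gt_0_iff_gt)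
  have "\<forall>\<^sub>F n::nat in sequentially. 1 / Suc n < d" using d(1) by real_asymp
  moreover have "\<forall>\<^sub>F n::nat in sequentially. t \<le> n" by real_asymp
  ultimately show ?thesis
  proof eventually_elim
    case (elim n)
    define j where "j = nat \<lfloor>s * Suc n\<rfloor>"
    define q where "q = 1 / Suc n * real j"
    have j: "real j \<le> s * Suc n" "s * Suc n < real j + 1"
      unfolding j_def using s(1) by (auto simp: of_nat_floor)
    have q: "q \<le> s" "s < q + 1 / Suc n" "0 \<le> q"
      using j unfolding q_def by (auto simp: field_simps)
    have "dist \<bar>W q \<omega>\<bar> \<bar>W s \<omega>\<bar> < 1 - c"
      using q elim(1) by (intro d(2)) (auto simp: dist_real_def)
    then have "c \<le> \<bar>W q \<omega>\<bar>" using s(3) unfolding dist_real_def by linarith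
    then have cw: "c \<le> \<bar>walk (\<lambda>i. increments W (1 / Suc n) i \<omega>) j\<bar>"
      unfolding walk_increments W0 q_def by simp
    have "real j \<le> real n * Suc n"
      using j(1) s(2) elim(2) by (meson mult_right_mono of_nat_0_le_iff order_trans)
    then have jm: "j \<le> Suc n * n" by (metis mult.commute of_nat_le_iff of_nat_mult)
    have "discount \<mu> (exit_time W \<omega>) = exp (- \<mu> * t)" using t by (simp add: discount_def)
    also have "\<dots> \<le> exp (- \<mu> * (1 / Suc n * real j))"
      using q(1) s(2) \<mu> unfolding q_def[symmetric] by (simp add: mult_left_mono)
    also have "\<dots> \<le> discounted_exit \<mu> c (1 / Suc n) (Suc n * n) (\<lambda>i. increments W (1 / Suc n) i \<omega>)"
      by (rule exp_le_discounted_exit[OF c(1) cw jm \<mu>]) simp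
    finally show ?case .
  qed
qed

section \<open>The law of the exit time of the Wiener process\<close>

lemma wiener_AE_path:
  assumes "wiener_process M W"
  shows "AE \<omega> in M. continuous_on {0..} (\<lambda>t. W t \<omega>) \<and> W 0 \<omega> = 0"
  using assms by (auto simp: wiener_process_def)

lemma exit_time_AE_measurable:
  assumes W: "wiener_process M W"
  obtains \<theta> where "\<theta> \<in> borel_measurable M" "AE \<omega> in M. exit_time W \<omega> = \<theta> \<omega>"
proof -
  have [measurable]: "W t \<in> borel_measurable M" if "0 \<le> t" for t
    using W that by (simp add: wiener_process_def)
  obtain N where N: "N \<in> null_sets M"
    "\<And>\<omega>. \<omega> \<in> space M \<Longrightarrow> \<omega> \<notin> N \<Longrightarrow> continuous_on {0..} (\<lambda>t. W t \<omega>) \<and> W 0 \<omega> = 0"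
    using wiener_AE_path[OF W] unfolding eventually_ae_filter by blast
  have [measurable]: "N \<in> sets M" using N(1) by auto
  define \<theta> where "\<theta> \<omega> = (if \<omega> \<in> N then 1 else exit_time W \<omega>)" for \<omega>
  have "\<theta> \<in> borel_measurable M"
  proof (rule borel_measurableI_le)
    fix y :: ennreal
    show "{\<omega> \<in> space M. \<theta> \<omega> \<le> y} \<in> sets M"
    proof (cases y)
      case (real t)
      have "{\<omega> \<in> space M. \<theta> \<omega> \<le> y} = {\<omega> \<in> space M. if \<omega> \<in> N then 1 \<le> y
          else 0 < t \<and> (\<forall>j::nat. \<exists>q\<in>\<rat> \<inter> {0..t}. 1 - 1 / Suc j < \<bar>W q \<omega>\<bar>)}"
      proof (intro Collect_cong conj_cong refl)
        fix \<omega> assume \<omega>: "\<omega> \<in> space M"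
        show "(\<theta> \<omega> \<le> y) = (if \<omega> \<in> N then 1 \<le> y
          else 0 < t \<and> (\<forall>j::nat. \<exists>q\<in>\<rat> \<inter> {0..t}. 1 - 1 / Suc j < \<bar>W q \<omega>\<bar>))"
        proof (cases "\<omega> \<in> N")
          case False
          then have path: "continuous_on {0..} (\<lambda>t. W t \<omega>)" "W 0 \<omega> = 0" using N(2) \<omega> by auto
          show ?thesis
          proof (cases "0 < t")
            case True
            then show ?thesis
              using exit_time_le_iff_rational[of W \<omega> t, OF path] False by (simp add: \<theta>_def real)
          next
            case f: False
            then have "t = 0" using real by simp
            then have "\<not> exit_time W \<omega> \<le> y"
              using exit_time_le_iff[of W \<omega> 0, OF path] path(2) unfolding real by simp
            then show ?thesis using f False by (simp add: \<theta>_def)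
          qed
        qed (simp add: \<theta>_def)
      qed
      also have "\<dots> \<in> sets M"
      proof -
        have [measurable]: "Measurable.pred M (\<lambda>\<omega>. \<exists>q\<in>\<rat> \<inter> {0..t}. 1 - 1 / Suc j < \<bar>W q \<omega>\<bar>)" for j :: nat
          unfolding pred_def
          by (intro sets.sets_Collect_countable_Ex' countable_Int1 countable_rat) auto
        show ?thesis by measurable
      qed
      finally show ?thesis .
    qed simp
  qed
  moreover have "AE \<omega> in M. exit_time W \<omega> = \<theta> \<omega>"
    using AE_not_in[OF N(1)] by eventually_elim (simp add: \<theta>_def)
  ultimately show ?thesis by (rule that)
qed


text \<open>The Laplace transform of the exit time. The grid walk at level 1 leaves after the path does, and the
grid walk at a level \<open>c < 1\<close> eventually leaves before it, so the transform is squeezed between the two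
discrete estimates.\<close>
lemma nn_integral_discount_exit_time:
  assumes W: "wiener_process M W" and a: "0 < a"
  shows "(\<integral>\<^sup>+\<omega>. ennreal (discount (a\<^sup>2 / 2) (exit_time W \<omega>)) \<partial>M) = ennreal (1 / cosh a)"
proof -
  define I where "I = (\<integral>\<^sup>+\<omega>. ennreal (discount (a\<^sup>2 / 2) (exit_time W \<omega>)) \<partial>M)"
  define \<mu> where "\<mu> = a\<^sup>2 / 2"
  have \<mu>: "0 \<le> \<mu>" by (simp add: \<mu>_def)
  let ?D = "\<lambda>c n m \<omega>. ennreal (discounted_exit \<mu> c (1 / Suc n) m (\<lambda>i. increments W (1 / Suc n) i \<omega>))"
  have walk: "gaussian_walk M (increments W (1 / Suc n)) (1 / Suc n)" for n :: nat
    by (rule wiener_gaussian_walk[OF W]) simp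
  have le: "I \<le> ennreal (1 / cosh (a * c))" if c: "0 < c" "c < 1" for c
  proof -
    have "I \<le> (\<integral>\<^sup>+\<omega>. liminf (\<lambda>n. ?D c n (Suc n * n) \<omega>) \<partial>M)"
      unfolding I_def \<mu>_def[symmetric]
    proof (rule nn_integral_mono_AE)
      show "AE \<omega> in M. ennreal (discount \<mu> (exit_time W \<omega>)) \<le> liminf (\<lambda>n. ?D c n (Suc n * n) \<omega>)"
        using wiener_AE_path[OF W]
      proof eventually_elim
        case (elim \<omega>)
        then have "\<forall>\<^sub>F n in sequentially. ennreal (discount \<mu> (exit_time W \<omega>)) \<le> ?D c n (Suc n * n) \<omega>"
          using eventually_discount_le_discounted_exit[of W \<omega>, OF _ _ \<mu> c]
          by (auto elim!: eventually_mono intro!: ennreal_leI)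
        then show ?case by (rule Liminf_bounded)
      qed
    qed
    also have "\<dots> \<le> liminf (\<lambda>n. \<integral>\<^sup>+\<omega>. ?D c n (Suc n * n) \<omega> \<partial>M)"
      using gaussian_walk.discounted_exit_measurable[OF walk]
      by (intro nn_integral_liminf) (simp add: measurable_compose[OF _ measurable_ennreal])
    also have "\<dots> \<le> ennreal (1 / cosh (a * c))"
      using gaussian_walk.discounted_exit_le[OF walk c(1), of a]
      by (intro Liminf_le) (auto simp: \<mu>_def)
    finally show ?thesis .
  qed
  have lim: "(\<lambda>n. ennreal (1 / cosh (a * (1 - 1 / real (n + 2))))) \<longlonglongrightarrow> ennreal (1 / cosh (a * (1 - 0)))"
    by (intro tendsto_ennrealI tendsto_divide tendsto_const tendsto_cosh tendsto_mult tendsto_diff) (real_asymp | simp)+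
  have "I \<le> ennreal (1 / cosh (a * (1 - 1 / real (n + 2))))" for n
    by (rule le) (auto simp: field_simps)
  then have "I \<le> ennreal (1 / cosh (a * (1 - 0)))"
    by (intro LIMSEQ_le_const[OF lim]) blast
  then have upper: "I \<le> ennreal (1 / cosh a)" by simp
  then obtain i where i: "I = ennreal i" "0 \<le> i" by (cases I) (auto simp: top_unique)
  \<comment> \<open>The tolerated overshoot must tend to 0, but more slowly than the typical step \<open>1 / sqrt (n + 1)\<close>.\<close>
  define \<eta> where "\<eta> n = (1 / real (Suc n)) powr (1 / 4)" for n
  define err where "err n = 2 * exp (a * 1 - \<eta> n / sqrt (1 / Suc n) + (a + 1 / sqrt (1 / Suc n))\<^sup>2 * (1 / Suc n) / 2)" for n :: nat
  have time: "1 / real (Suc n) * real (Suc n * n) = n" for n :: nat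
    unfolding of_nat_mult by (simp del: of_nat_Suc)
  have bound: "1 \<le> exp (- \<mu> * n) * cosh (a * 1) + cosh (a * (1 + \<eta> n)) * i + real (Suc n * n) * err n" for n :: nat
  proof -
    have "(\<integral>\<^sup>+\<omega>. ?D 1 n (Suc n * n) \<omega> \<partial>M) \<le> I"
      unfolding I_def \<mu>_def[symmetric]
    proof (rule nn_integral_mono_AE)
      show "AE \<omega> in M. ?D 1 n (Suc n * n) \<omega> \<le> ennreal (discount \<mu> (exit_time W \<omega>))"
        using wiener_AE_path[OF W]
        by eventually_elim (auto intro!: ennreal_leI discounted_exit_le_discount \<mu>)
    qed
    moreover have "1 \<le> ennreal (exp (- \<mu> * (1 / Suc n * real (Suc n * n))) * cosh (a * 1))
      + ennreal (cosh (a * (1 + \<eta> n))) * (\<integral>\<^sup>+\<omega>. ?D 1 n (Suc n * n) \<omega> \<partial>M) + ennreal (real (Suc n * n) * err n)"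
      using gaussian_walk.one_le_discounted_exit[OF walk[of n], of a 1 "Suc n * n" "\<eta> n"] a
      unfolding \<mu>_def[symmetric] err_def gaussian_walk.overshoot_error_def[OF walk[of n]] by simp
    ultimately have "1 \<le> ennreal (exp (- \<mu> * (1 / Suc n * real (Suc n * n))) * cosh (a * 1))
      + ennreal (cosh (a * (1 + \<eta> n))) * I + ennreal (real (Suc n * n) * err n)"
      by (elim order_trans) (intro add_mono mult_left_mono order_refl; simp)
    also have "\<dots> = ennreal (exp (- \<mu> * n) * cosh (a * 1) + cosh (a * (1 + \<eta> n)) * i + real (Suc n * n) * err n)"
      unfolding i(1) time using i(2) by (simp add: err_def flip: ennreal_mult ennreal_plus)
    finally show ?thesis by simp
  qed
  have \<eta>: "\<eta> \<longlonglongrightarrow> 0" unfolding \<eta>_def by real_asymp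
  have "(\<lambda>n. real (Suc n * n) * err n) \<longlonglongrightarrow> 0"
    unfolding err_def \<eta>_def by real_asymp
  moreover have "(\<lambda>n::nat. exp (- \<mu> * n)) \<longlonglongrightarrow> 0"
    using a unfolding \<mu>_def by real_asymp
  ultimately have "(\<lambda>n. exp (- \<mu> * n) * cosh (a * 1) + cosh (a * (1 + \<eta> n)) * i + real (Suc n * n) * err n)
      \<longlonglongrightarrow> 0 * cosh (a * 1) + cosh (a * (1 + 0)) * i + 0"
    by (intro tendsto_intros \<eta>)
  then have "1 \<le> 0 * cosh (a * 1) + cosh (a * (1 + 0)) * i + 0"
    by (rule LIMSEQ_le_const) (use bound in auto)
  then have "1 / cosh a \<le> i" by (simp add: field_simps)
  then have "ennreal (1 / cosh a) \<le> I" unfolding i(1) by (rule ennreal_leI)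
  with upper show ?thesis unfolding I_def by (rule antisym)
qed


text \<open>Parametrising the discount rate as \<open>x\<^sup>2 / 2\<close> turns the transform \<open>1 / cosh x\<close> directly into the
integrand \<open>x / cosh x\<close>.\<close>
lemma inverse_eq_nn_integral_discount:
  assumes "\<theta> \<noteq> 0"
  shows "inverse \<theta> = (\<integral>\<^sup>+x\<in>{0..}. ennreal (x * discount (x\<^sup>2 / 2) \<theta>) \<partial>lborel)"
proof (cases \<theta>)
  case (real t)
  with assms have t: "0 < t" by auto
  have "(\<integral>\<^sup>+x\<in>{0..}. ennreal (x * exp (- (x\<^sup>2 / 2) * t)) \<partial>lborel) = ennreal (0 - (- exp (- (0\<^sup>2 / 2) * t) / t))"
  proof (rule nn_integral_FTC_atLeast)
    show "DERIV (\<lambda>x. - exp (- (x\<^sup>2 / 2) * t) / t) x :> x * exp (- (x\<^sup>2 / 2) * t)" for x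
      using t by (auto intro!: derivative_eq_intros)
    show "((\<lambda>x. - exp (- (x\<^sup>2 / 2) * t) / t) \<longlongrightarrow> 0) at_top"
      using t by real_asymp
  qed auto
  also have "\<dots> = inverse \<theta>"
    using t real by (simp add: inverse_ennreal inverse_eq_divide)
  finally show ?thesis using t real by (simp add: discount_def)
qed (simp add: discount_def)

lemma nn_integral_discount_eq:
  assumes W: "wiener_process M W" and "AE \<omega> in M. exit_time W \<omega> = \<theta> \<omega>" and "0 < a"
  shows "(\<integral>\<^sup>+\<omega>. ennreal (discount (a\<^sup>2 / 2) (\<theta> \<omega>)) \<partial>M) = ennreal (1 / cosh a)"
  unfolding nn_integral_discount_exit_time[OF W \<open>0 < a\<close>, symmetric]
  using assms(2) by (intro nn_integral_cong_AE) auto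

lemma expectation_inverse_exit_time:
  assumes W: "wiener_process M W"
  shows "(\<integral>\<^sup>+\<omega>. inverse (exit_time W \<omega>) \<partial>M) = (\<integral>\<^sup>+x\<in>{0..}. ennreal (x / cosh x) \<partial>lborel)"
proof -
  obtain \<theta> where \<theta> [measurable]: "\<theta> \<in> borel_measurable M" and eq: "AE \<omega> in M. exit_time W \<omega> = \<theta> \<omega>"
    using exit_time_AE_measurable[OF W] .
  interpret prob_space M using W by (simp add: wiener_process_def)
  interpret pair_sigma_finite M lborel ..
  have "(\<integral>\<^sup>+\<omega>. inverse (exit_time W \<omega>) \<partial>M)
      = (\<integral>\<^sup>+\<omega>. \<integral>\<^sup>+x. ennreal (x * discount (x\<^sup>2 / 2) (\<theta> \<omega>)) * indicator {0..} x \<partial>lborel \<partial>M)"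
  proof (rule nn_integral_cong_AE)
    show "AE \<omega> in M. inverse (exit_time W \<omega>)
        = (\<integral>\<^sup>+x. ennreal (x * discount (x\<^sup>2 / 2) (\<theta> \<omega>)) * indicator {0..} x \<partial>lborel)"
      using wiener_AE_path[OF W] eq
    proof eventually_elim
      case (elim \<omega>)
      then have "\<not> exit_time W \<omega> \<le> ennreal 0"
        using exit_time_le_iff[of W \<omega> 0] by auto
      then have "\<theta> \<omega> \<noteq> 0" using elim by auto
      then show ?case using elim inverse_eq_nn_integral_discount by simp
    qed
  qed
  also have "\<dots> = (\<integral>\<^sup>+x. \<integral>\<^sup>+\<omega>. ennreal (x * discount (x\<^sup>2 / 2) (\<theta> \<omega>)) * indicator {0..} x \<partial>M \<partial>lborel)"
    unfolding discount_def by (rule Fubini'[symmetric]) measurable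
  also have "\<dots> = (\<integral>\<^sup>+x\<in>{0..}. ennreal (x / cosh x) \<partial>lborel)"
  proof (rule nn_integral_cong)
    fix x :: real
    show "(\<integral>\<^sup>+\<omega>. ennreal (x * discount (x\<^sup>2 / 2) (\<theta> \<omega>)) * indicator {0..} x \<partial>M) = ennreal (x / cosh x) * indicator {0..} x"
    proof (cases "0 < x")
      case True
      then have "(\<integral>\<^sup>+\<omega>. ennreal (x * discount (x\<^sup>2 / 2) (\<theta> \<omega>)) * indicator {0..} x \<partial>M)
          = (\<integral>\<^sup>+\<omega>. ennreal x * ennreal (discount (x\<^sup>2 / 2) (\<theta> \<omega>)) \<partial>M)"
        by (simp add: ennreal_mult)
      also have "\<dots> = ennreal x * ennreal (1 / cosh x)"
        using nn_integral_discount_eq[OF W eq True] by (subst nn_integral_cmult) auto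
      finally show ?thesis using True by (simp flip: ennreal_mult)
    qed (auto simp: indicator_def not_less)
  qed
  finally show ?thesis .
qed

text \<open>The expectation is the slope at 0 of the Laplace transform: \<open>(1 - exp (- l \<theta>)) / l\<close> is at most \<open>\<theta>\<close> and
converges to it as \<open>l\<close> tends to 0, including the case of infinite \<open>\<theta>\<close>, and Fatou's lemma gives the
other inequality.\<close>
lemma expectation_exit_time:
  assumes W: "wiener_process M W"
  shows "(\<integral>\<^sup>+\<omega>. exit_time W \<omega> \<partial>M) = 1"
proof -
  obtain \<theta> where \<theta> [measurable]: "\<theta> \<in> borel_measurable M" and eq: "AE \<omega> in M. exit_time W \<omega> = \<theta> \<omega>"
    using exit_time_AE_measurable[OF W] .
  interpret prob_space M using W by (simp add: wiener_process_def)
  define a where "a n = 1 / real (Suc n)" for n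
  have a: "0 < a n" for n by (simp add: a_def)
  define \<psi> where "\<psi> n t = (1 - discount ((a n)\<^sup>2 / 2) t) / ((a n)\<^sup>2 / 2)" for n t
  have [measurable]: "\<psi> n \<in> borel_measurable borel" for n unfolding \<psi>_def by measurable
  have int: "(\<integral>\<^sup>+\<omega>. ennreal (\<psi> n (\<theta> \<omega>)) \<partial>M) = ennreal ((1 - 1 / cosh (a n)) / ((a n)\<^sup>2 / 2))" for n
  proof -
    define b where "b = 1 / ((a n)\<^sup>2 / 2)"
    have b: "0 < b" using a[of n] by (simp add: b_def)
    have "(\<integral>\<^sup>+\<omega>. ennreal (1 - discount ((a n)\<^sup>2 / 2) (\<theta> \<omega>)) \<partial>M)
        = (\<integral>\<^sup>+\<omega>. 1 - ennreal (discount ((a n)\<^sup>2 / 2) (\<theta> \<omega>)) \<partial>M)"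
      by (simp add: ennreal_minus flip: ennreal_1)
    also have "\<dots> = 1 - ennreal (1 / cosh (a n))"
      using nn_integral_discount_eq[OF W eq a[of n]]
      by (subst nn_integral_diff) (auto simp: emeasure_space_1 discount_le_1)
    also have "\<dots> = ennreal (1 - 1 / cosh (a n))"
      by (simp add: ennreal_minus flip: ennreal_1)
    finally have *: "(\<integral>\<^sup>+\<omega>. ennreal (1 - discount ((a n)\<^sup>2 / 2) (\<theta> \<omega>)) \<partial>M) = ennreal (1 - 1 / cosh (a n))" .
    have "(\<integral>\<^sup>+\<omega>. ennreal (\<psi> n (\<theta> \<omega>)) \<partial>M) = (\<integral>\<^sup>+\<omega>. ennreal b * ennreal (1 - discount ((a n)\<^sup>2 / 2) (\<theta> \<omega>)) \<partial>M)"
      unfolding \<psi>_def using b by (intro nn_integral_cong) (simp add: b_def discount_le_1 flip: ennreal_mult)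
    also have "\<dots> = ennreal b * ennreal (1 - 1 / cosh (a n))"
      by (subst nn_integral_cmult) (auto simp: *)
    also have "\<dots> = ennreal ((1 - 1 / cosh (a n)) / ((a n)\<^sup>2 / 2))"
      using b cosh_real_ge_1[of "a n"] by (simp add: b_def flip: ennreal_mult)
    finally show ?thesis .
  qed
  have lim: "(\<lambda>n. ennreal ((1 - 1 / cosh (a n)) / ((a n)\<^sup>2 / 2))) \<longlonglongrightarrow> ennreal 1"
    unfolding a_def cosh_field_def by (intro tendsto_ennrealI) real_asymp
  have le: "ennreal (\<psi> n t) \<le> t" for n t
  proof (cases t)
    case (real r)
    define l where "l = (a n)\<^sup>2 / 2"
    have "0 < l" using a[of n] by (simp add: l_def)
    moreover have "1 - exp (- l * r) \<le> l * r" using exp_ge_add_one_self[of "- l * r"] by simp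
    ultimately have "(1 - exp (- l * r)) / l \<le> r" by (simp add: field_simps)
    then show ?thesis using real unfolding \<psi>_def l_def[symmetric] by (simp add: discount_def ennreal_leI)
  qed simp
  have conv: "(\<lambda>n. ennreal (\<psi> n t)) \<longlonglongrightarrow> t" for t
  proof (cases t)
    case (real r)
    have "(\<lambda>n. (1 - exp (- ((a n)\<^sup>2 / 2) * r)) / ((a n)\<^sup>2 / 2)) \<longlonglongrightarrow> r"
      unfolding a_def by real_asymp
    then show ?thesis using real by (simp add: \<psi>_def discount_def tendsto_ennrealI)
  next
    case top
    have "LIM n sequentially. 1 / ((a n)\<^sup>2 / 2) :> at_top"
      unfolding a_def by real_asymp
    then show ?thesis using top by (simp add: \<psi>_def discount_def ennreal_tendsto_top_eq_at_top)
  qed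
  have "(\<integral>\<^sup>+\<omega>. \<theta> \<omega> \<partial>M) = (\<integral>\<^sup>+\<omega>. liminf (\<lambda>n. ennreal (\<psi> n (\<theta> \<omega>))) \<partial>M)"
    by (intro nn_integral_cong lim_imp_Liminf[symmetric] conv) simp
  also have "\<dots> \<le> liminf (\<lambda>n. \<integral>\<^sup>+\<omega>. ennreal (\<psi> n (\<theta> \<omega>)) \<partial>M)"
    by (rule nn_integral_liminf) measurable
  also have "\<dots> = ennreal 1"
    unfolding int by (rule lim_imp_Liminf[OF _ lim]) simp
  finally have "(\<integral>\<^sup>+\<omega>. \<theta> \<omega> \<partial>M) \<le> 1" by simp
  moreover have "ennreal 1 \<le> (\<integral>\<^sup>+\<omega>. \<theta> \<omega> \<partial>M)"
  proof (rule LIMSEQ_le_const2[OF lim], intro exI allI impI)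
    fix n
    show "ennreal ((1 - 1 / cosh (a n)) / ((a n)\<^sup>2 / 2)) \<le> (\<integral>\<^sup>+\<omega>. \<theta> \<omega> \<partial>M)"
      unfolding int[symmetric] by (intro nn_integral_mono le)
  qed
  moreover have "(\<integral>\<^sup>+\<omega>. exit_time W \<omega> \<partial>M) = (\<integral>\<^sup>+\<omega>. \<theta> \<omega> \<partial>M)"
    by (rule nn_integral_cong_AE[OF eq])
  ultimately show ?thesis by (simp add: antisym)
qed

lemma nn_integral_x_over_cosh_finite: "(\<integral>\<^sup>+x\<in>{0..}. ennreal (x / cosh x) \<partial>lborel) < top"
proof -
  have "x / cosh x \<le> 2 * (x ^ 1 * exp (- x))" if "0 \<le> x" for x :: real
  proof -
    have "exp x \<le> 2 * cosh x" using exp_abs_le_cosh[of x] that by simp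
    then have "x * exp x \<le> x * (2 * cosh x)" using that by (rule mult_left_mono)
    then show ?thesis by (simp add: field_simps exp_minus)
  qed
  then have "(\<integral>\<^sup>+x\<in>{0..}. ennreal (x / cosh x) \<partial>lborel)
      \<le> (\<integral>\<^sup>+x. 2 * (ennreal (x ^ 1 * exp (- x)) * indicator {0..} x) \<partial>lborel)"
    by (intro nn_integral_mono) (auto simp: indicator_def ennreal_leI ennreal_mult' simp flip: ennreal_numeral ennreal_mult')
  also have "\<dots> = 2 * ennreal (real (fact 1))"
    by (subst nn_integral_cmult, measurable, subst nn_intergal_power_times_exp_Ici, rule refl)
  also have "\<dots> < top" by (simp add: ennreal_mult_less_top)
  finally show ?thesis .
qed


section \<open>The string through the restarts of a walk\<close>

text \<open>The walk with steps \<open>x\<close> is restarted from 0 whenever its modulus reaches \<open>r\<close>. The three functions give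
its current position, the time since the last restart, and the energy spent on the completed pieces,
where each piece is charged as if it climbed the height \<open>R\<close>. This fixed charge keeps the overshoot out
of the expectation; it is an upper bound for the true energy as long as no step exceeds \<open>R - r\<close>.\<close>
primrec offset :: "real \<Rightarrow> (nat \<Rightarrow> real) \<Rightarrow> nat \<Rightarrow> real" where
  "offset r x 0 = 0"
| "offset r x (Suc k) = (if r \<le> \<bar>offset r x k + x k\<bar> then 0 else offset r x k + x k)"

primrec age :: "real \<Rightarrow> real \<Rightarrow> (nat \<Rightarrow> real) \<Rightarrow> nat \<Rightarrow> real" where
  "age r \<delta> x 0 = 0"
| "age r \<delta> x (Suc k) = (if r \<le> \<bar>offset r x k + x k\<bar> then 0 else age r \<delta> x k + \<delta>)"

primrec cost :: "real \<Rightarrow> real \<Rightarrow> real \<Rightarrow> (nat \<Rightarrow> real) \<Rightarrow> nat \<Rightarrow> real" where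
  "cost r R \<delta> x 0 = 0"
| "cost r R \<delta> x (Suc k) = cost r R \<delta> x k + (if r \<le> \<bar>offset r x k + x k\<bar> then R\<^sup>2 / (age r \<delta> x k + \<delta>) else 0)"

lemma abs_offset_less: "0 < r \<Longrightarrow> \<bar>offset r x k\<bar> < r"
  by (cases k) auto

lemma age_nonneg: "0 \<le> \<delta> \<Longrightarrow> 0 \<le> age r \<delta> x k"
  by (induction k) auto

lemma age_le: "0 \<le> \<delta> \<Longrightarrow> age r \<delta> x k \<le> \<delta> * k"
  by (induction k) (auto simp: algebra_simps)

lemma cost_nonneg: "0 \<le> \<delta> \<Longrightarrow> 0 \<le> cost r R \<delta> x k"
  by (induction k) (auto intro!: add_nonneg_nonneg divide_nonneg_nonneg age_nonneg)

definition ramp :: "real \<Rightarrow> real \<Rightarrow> real \<Rightarrow> real" where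
  "ramp l b t = max 0 (min 1 ((t - l) / (b - l)))"

lemma ramp_lipschitz:
  assumes "l < b"
  shows "\<bar>ramp l b s - ramp l b t\<bar> \<le> (1 / (b - l)) * \<bar>s - t\<bar>"
proof -
  have "\<bar>ramp l b s - ramp l b t\<bar> \<le> \<bar>(s - l) / (b - l) - (t - l) / (b - l)\<bar>"
    unfolding ramp_def by (auto simp: max_def min_def abs_if)
  also have "\<dots> = (1 / (b - l)) * \<bar>s - t\<bar>"
    using assms by (simp add: abs_divide flip: diff_divide_distrib)
  finally show ?thesis .
qed

lemma ramp_simps:
  assumes "l < b"
  shows "t \<le> l \<Longrightarrow> ramp l b t = 0" "b \<le> t \<Longrightarrow> ramp l b t = 1" "0 \<le> ramp l b t" "ramp l b t \<le> 1"
  using assms by (auto simp: ramp_def divide_le_0_iff le_divide_eq max_def min_def not_le)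

lemma ramp_linear: "l < b \<Longrightarrow> l \<le> t \<Longrightarrow> t \<le> b \<Longrightarrow> ramp l b t = (t - l) / (b - l)"
  by (simp add: ramp_def)

definition lipschitz_real :: "(real \<Rightarrow> real) \<Rightarrow> bool" where
  "lipschitz_real h \<longleftrightarrow> (\<exists>B\<ge>0. \<forall>s t. \<bar>h s - h t\<bar> \<le> B * \<bar>s - t\<bar>)"

text \<open>The string is extended by adding a ramp to a function that is constant from \<open>l\<close> on. A sum of two
Lipschitz functions is Lipschitz, so nothing has to be glued.\<close>
lemma lipschitz_add_ramp:
  assumes "lipschitz_real h" "l < b"
  shows "lipschitz_real (\<lambda>t. h t + y * ramp l b t)"
proof -
  obtain B where B: "0 \<le> B" "\<And>s t. \<bar>h s - h t\<bar> \<le> B * \<bar>s - t\<bar>"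
    using assms(1) unfolding lipschitz_real_def by blast
  define D where "D = \<bar>y\<bar> * (1 / (b - l))"
  have "0 \<le> D" using assms(2) by (simp add: D_def)
  moreover have "\<bar>h s + y * ramp l b s - (h t + y * ramp l b t)\<bar> \<le> (B + D) * \<bar>s - t\<bar>" for s t
  proof -
    have "\<bar>h s + y * ramp l b s - (h t + y * ramp l b t)\<bar> \<le> \<bar>h s - h t\<bar> + \<bar>y * (ramp l b s - ramp l b t)\<bar>"
      by (simp add: algebra_simps)
    also have "\<bar>y * (ramp l b s - ramp l b t)\<bar> \<le> D * \<bar>s - t\<bar>"
      unfolding abs_mult D_def mult.assoc by (intro mult_left_mono ramp_lipschitz assms) simp
    finally show ?thesis using B(2)[of s t] by (simp add: distrib_right)
  qed
  ultimately show ?thesis unfolding lipschitz_real_def using B(1) by (intro exI[of _ "B + D"]) auto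
qed

lemma lipschitz_imp_abs_continuous:
  assumes "lipschitz_real h"
  shows "abs_continuous_on a b h"
proof -
  obtain B where B: "0 \<le> B" "\<And>s t. \<bar>h s - h t\<bar> \<le> B * \<bar>s - t\<bar>"
    using assms(1) unfolding lipschitz_real_def by blast
  show ?thesis
    unfolding abs_continuous_on_def
  proof (intro allI impI)
    fix e :: real assume e: "0 < e"
    show "\<exists>d>0. \<forall>(n::nat) (l::nat \<Rightarrow> real) (u::nat \<Rightarrow> real).
        (\<forall>i<n. a \<le> l i \<and> l i \<le> u i \<and> u i \<le> b) \<and> disjoint_family_on (\<lambda>i. {l i<..<u i}) {..<n} \<and>
        (\<Sum>i<n. u i - l i) < d \<longrightarrow> (\<Sum>i<n. \<bar>h (u i) - h (l i)\<bar>) < e"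
    proof (intro exI[of _ "e / (B + 1)"] conjI allI impI)
      show "0 < e / (B + 1)" using e B(1) by simp
    next
      fix n :: nat and l u :: "nat \<Rightarrow> real"
      assume *: "(\<forall>i<n. a \<le> l i \<and> l i \<le> u i \<and> u i \<le> b) \<and> disjoint_family_on (\<lambda>i. {l i<..<u i}) {..<n} \<and>
        (\<Sum>i<n. u i - l i) < e / (B + 1)"
      have nonneg: "0 \<le> (\<Sum>i<n. u i - l i)" using * by (intro sum_nonneg) auto
      have "(\<Sum>i<n. \<bar>h (u i) - h (l i)\<bar>) \<le> (\<Sum>i<n. B * (u i - l i))"
      proof (rule sum_mono)
        fix i assume "i \<in> {..<n}"
        then have "l i \<le> u i" using * by auto
        then show "\<bar>h (u i) - h (l i)\<bar> \<le> B * (u i - l i)" using B(2)[of "u i" "l i"] by simp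
      qed
      also have "\<dots> = B * (\<Sum>i<n. u i - l i)" by (simp add: sum_distrib_left)
      also have "\<dots> \<le> (B + 1) * (\<Sum>i<n. u i - l i)" using nonneg by (simp add: distrib_right)
      also have "\<dots> < e" using * B(1) by (simp add: field_simps)
      finally show "(\<Sum>i<n. \<bar>h (u i) - h (l i)\<bar>) < e" .
    qed
  qed
qed

text \<open>A measurable majorant of the squared derivative. It is used in place of \<open>deriv h\<close> itself because the
integral of a sum splits only for measurable summands, and measurability of \<open>deriv h\<close> would need a
separate argument.\<close>
definition energy_density :: "(real \<Rightarrow> real) \<Rightarrow> (real \<Rightarrow> ennreal) \<Rightarrow> bool" where
  "energy_density h G \<longleftrightarrow> G \<in> borel_measurable borel \<and> (AE t in lborel. 0 \<le> t \<longrightarrow> ennreal ((deriv h t)\<^sup>2) \<le> G t)"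

lemma energy_density_add_ramp:
  assumes G: "energy_density h G" and lb: "0 \<le> l" "l < b" and const: "\<And>t. l \<le> t \<Longrightarrow> h t = c"
  shows "energy_density (\<lambda>t. h t + y * ramp l b t) (\<lambda>t. G t + ennreal ((y / (b - l))\<^sup>2) * indicator {l..b} t)"
    (is "energy_density ?h ?G")
  unfolding energy_density_def
proof
  show "?G \<in> borel_measurable borel" using G unfolding energy_density_def by auto
  have "AE t in lborel. 0 \<le> t \<longrightarrow> ennreal ((deriv h t)\<^sup>2) \<le> G t" using G unfolding energy_density_def by simp
  moreover have "AE t in lborel. t \<noteq> l" "AE t in lborel. t \<noteq> b" by (rule AE_lborel_singleton)+
  ultimately show "AE t in lborel. 0 \<le> t \<longrightarrow> ennreal ((deriv ?h t)\<^sup>2) \<le> ?G t"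
  proof eventually_elim
    case (elim t)
    consider "t < l" | "l < t" "t < b" | "b < t" using elim by linarith
    then have "ennreal ((deriv ?h t)\<^sup>2) \<le> ?G t" if "0 \<le> t"
    proof cases
      case 1
      then have "\<forall>\<^sub>F s in nhds t. ?h s = h s"
        using lb ramp_simps(1)[OF lb(2)] by (intro eventually_nhds_in_open[of "{..<l}", THEN eventually_mono]) auto
      then have "deriv ?h t = deriv h t" by (rule deriv_cong_ev) simp
      then show ?thesis using elim that by (auto intro: order_trans)
    next
      case 2
      have "((\<lambda>s. c + y * ((s - l) / (b - l))) has_real_derivative y / (b - l)) (at t)"
        using lb by (auto intro!: derivative_eq_intros)
      then have "(?h has_real_derivative y / (b - l)) (at t)"
        by (rule has_field_derivative_transform_within_open[where S="{l<..<b}"])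
           (use 2 const ramp_linear[OF lb(2)] in auto)
      then have "deriv ?h t = y / (b - l)" by (rule DERIV_imp_deriv)
      then show ?thesis using 2 by (simp add: add_increasing)
    next
      case 3
      have "((\<lambda>s. c + y) has_real_derivative 0) (at t)" by simp
      then have "(?h has_real_derivative 0) (at t)"
        by (rule has_field_derivative_transform_within_open[where S="{b<..}"])
           (use 3 lb const ramp_simps(2)[OF lb(2)] in auto)
      then have "deriv ?h t = 0" by (rule DERIV_imp_deriv)
      then show ?thesis by simp
    qed
    then show ?case by blast
  qed
qed

text \<open>The string interpolates the path linearly between restarts and is constant after the last one. Between
two restarts the path and the string both stay within \<open>R\<close> of the position of the path at the earlier
one, hence within \<open>2 R\<close> of each other. The induction has to remember that the path has stayed close to
that position since the last restart, because a later restart bends the string on this whole interval.\<close>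
lemma string_through_restarts:
  fixes w :: "real \<Rightarrow> real" and \<delta> r \<eta> R :: real and n k :: nat
  defines "x \<equiv> (\<lambda>k. w (\<delta> * Suc k) - w (\<delta> * k))"
  assumes \<delta>: "0 < \<delta>" and r: "0 < r" and \<eta>: "0 \<le> \<eta>" and w0: "w 0 = 0" and R: "R = r + \<eta>"
    and osc: "\<And>s t. 0 \<le> s \<Longrightarrow> s \<le> t \<Longrightarrow> t \<le> \<delta> * n \<Longrightarrow> t - s \<le> \<delta> \<Longrightarrow> \<bar>w t - w s\<bar> \<le> \<eta>"
    and "k \<le> n"
  shows "\<exists>h G. lipschitz_real h \<and> h 0 = 0 \<and> energy_density h G \<and>
      (\<integral>\<^sup>+t. G t \<partial>lborel) \<le> ennreal (cost r R \<delta> x k) \<and>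
      (\<forall>t\<ge>\<delta> * k - age r \<delta> x k. h t = w (\<delta> * k) - offset r x k) \<and>
      (\<forall>t\<in>{0..\<delta> * k}. \<bar>h t - w t\<bar> \<le> 2 * R) \<and>
      (\<forall>t\<in>{\<delta> * k - age r \<delta> x k..\<delta> * k}. \<bar>w t - (w (\<delta> * k) - offset r x k)\<bar> \<le> R)"
  using \<open>k \<le> n\<close>
proof (induction k)
  case 0
  show ?case
    by (intro exI[of _ "\<lambda>_. 0"]) (use r \<eta> w0 R in \<open>auto simp: lipschitz_real_def energy_density_def intro!: exI[of _ 0]\<close>)
next
  case (Suc k)
  define l where "l = \<delta> * k - age r \<delta> x k"
  define b where "b = \<delta> * Suc k"
  define c where "c = w (\<delta> * k) - offset r x k"
  define y where "y = offset r x k + x k"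
  obtain h G where h: "lipschitz_real h" "h 0 = 0" and G: "energy_density h G"
      "(\<integral>\<^sup>+t. G t \<partial>lborel) \<le> ennreal (cost r R \<delta> x k)"
    and const: "\<And>t. l \<le> t \<Longrightarrow> h t = c"
    and close: "\<And>t. 0 \<le> t \<Longrightarrow> t \<le> \<delta> * k \<Longrightarrow> \<bar>h t - w t\<bar> \<le> 2 * R"
    and near: "\<And>t. l \<le> t \<Longrightarrow> t \<le> \<delta> * k \<Longrightarrow> \<bar>w t - c\<bar> \<le> R"
    using Suc.IH Suc.prems unfolding l_def c_def by (auto simp: Ball_def)
  have age: "0 \<le> age r \<delta> x k" using \<delta> by (simp add: age_nonneg)
  have l: "0 \<le> l" "l \<le> \<delta> * k" using age_le[of \<delta> r x k] age \<delta> by (auto simp: l_def)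
  have b: "b = \<delta> * k + \<delta>" "b - l = age r \<delta> x k + \<delta>" by (auto simp: b_def l_def algebra_simps)
  have lb: "l < b" using age \<delta> b(2) by linarith
  have off: "\<bar>offset r x k\<bar> < r" by (rule abs_offset_less[OF r])
  have bn: "b \<le> \<delta> * n" unfolding b_def using Suc.prems \<delta> by (intro mult_left_mono) auto
  have cell: "\<bar>w t - c\<bar> \<le> R" if "\<delta> * k \<le> t" "t \<le> b" for t
  proof -
    have "\<bar>w t - w (\<delta> * k)\<bar> \<le> \<eta>" using that \<delta> b(1) bn by (intro osc) auto
    then show ?thesis using off unfolding c_def R by linarith
  qed
  have near': "\<bar>w t - c\<bar> \<le> R" if "l \<le> t" "t \<le> b" for t
    using near[of t] cell[of t] that by linarith
  have wb: "w b = c + y" unfolding c_def y_def b_def x_def by simp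
  have y: "\<bar>y\<bar> \<le> R" using near'[of b] lb wb by simp
  have R0: "0 < R" using r \<eta> R by simp
  show ?case
  proof (cases "r \<le> \<bar>y\<bar>")
    case False
    then have upd: "offset r x (Suc k) = y" "age r \<delta> x (Suc k) = age r \<delta> x k + \<delta>"
        "cost r R \<delta> x (Suc k) = cost r R \<delta> x k"
      by (auto simp: y_def)
    have start: "\<delta> * Suc k - age r \<delta> x (Suc k) = l" and pos: "w (\<delta> * Suc k) - offset r x (Suc k) = c"
      using b wb unfolding upd by (auto simp: b_def l_def)
    have "\<bar>h t - w t\<bar> \<le> 2 * R" if "0 \<le> t" "t \<le> b" for t
    proof (cases "t \<le> \<delta> * k")
      case True
      then show ?thesis using close that by simp
    next
      case False
      then show ?thesis using const[of t] cell[of t] l that R0 by simp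
    qed
    then show ?thesis
      unfolding start pos upd(3) unfolding b_def[symmetric]
      using h G const near' by (intro exI[of _ h] exI[of _ G]) (auto simp del: offset.simps age.simps cost.simps)
  next
    case True
    then have upd: "offset r x (Suc k) = 0" "age r \<delta> x (Suc k) = 0"
        "cost r R \<delta> x (Suc k) = cost r R \<delta> x k + R\<^sup>2 / (b - l)"
      by (auto simp: y_def b(2))
    let ?h = "\<lambda>t. h t + y * ramp l b t"
    let ?G = "\<lambda>t. G t + ennreal ((y / (b - l))\<^sup>2) * indicator {l..b} t"
    have mG: "G \<in> borel_measurable borel" using G(1) by (simp add: energy_density_def)
    have "(\<integral>\<^sup>+t. ?G t \<partial>lborel) = (\<integral>\<^sup>+t. G t \<partial>lborel) + ennreal ((y / (b - l))\<^sup>2) * ennreal (b - l)"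
      using mG lb by (subst nn_integral_add) (auto simp: nn_integral_cmult_indicator)
    also have "\<dots> \<le> ennreal (cost r R \<delta> x k) + ennreal (R\<^sup>2 / (b - l))"
    proof (intro add_mono G(2))
      have "(y / (b - l))\<^sup>2 * (b - l) = y\<^sup>2 / (b - l)" using lb by (simp add: power2_eq_square)
      also have "\<dots> \<le> R\<^sup>2 / (b - l)"
        using lb y by (intro divide_right_mono) (auto simp: power2_le_iff_abs_le abs_le_square_iff[symmetric])
      finally show "ennreal ((y / (b - l))\<^sup>2) * ennreal (b - l) \<le> ennreal (R\<^sup>2 / (b - l))"
        using lb by (simp add: ennreal_leI flip: ennreal_mult)
    qed
    also have "\<dots> = ennreal (cost r R \<delta> x (Suc k))"
      unfolding upd(3) using lb \<delta> by (intro ennreal_plus[symmetric] cost_nonneg) auto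
    finally have int: "(\<integral>\<^sup>+t. ?G t \<partial>lborel) \<le> ennreal (cost r R \<delta> x (Suc k))" .
    have close': "\<bar>?h t - w t\<bar> \<le> 2 * R" if "0 \<le> t" "t \<le> b" for t
    proof (cases "t \<le> l")
      case True
      then show ?thesis using close[of t] that l ramp_simps(1)[OF lb True] by simp
    next
      case False
      have "\<bar>y * ramp l b t\<bar> \<le> R * 1"
        unfolding abs_mult using y ramp_simps(3,4)[OF lb] R0 by (intro mult_mono) auto
      then show ?thesis using const[of t] near'[of t] False that by simp
    qed
    have "?h t = w b" if "b \<le> t" for t
      using that const[of t] lb ramp_simps(2)[OF lb that] wb by simp
    moreover have "?h 0 = 0" using h(2) ramp_simps(1)[OF lb l(1)] by simp
    ultimately show ?thesis
      unfolding upd(1,2) unfolding b_def[symmetric]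
      using lipschitz_add_ramp[OF h(1) lb, of y] energy_density_add_ramp[OF G(1) l(1) lb const, of y] int close' R0
      by (intro exI[of _ ?h] exI[of _ ?G]) (auto simp del: cost.simps)
  qed
qed


lemma energy_norm_le:
  assumes G: "energy_density h G" "(\<integral>\<^sup>+t. G t \<partial>lborel) \<le> ennreal c" and c: "0 \<le> c"
  shows "energy_norm h \<le> ennreal (sqrt c)"
proof -
  let ?I = "\<integral>\<^sup>+t\<in>{0..1}. ennreal ((deriv h t)\<^sup>2) \<partial>lebesgue"
  have "?I \<le> (\<integral>\<^sup>+t. G t \<partial>lborel)"
    unfolding nn_integral_completion
  proof (rule nn_integral_mono_AE)
    have "AE t in lborel. 0 \<le> t \<longrightarrow> ennreal ((deriv h t)\<^sup>2) \<le> G t"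
      using G(1) by (simp add: energy_density_def)
    then show "AE t in lborel. ennreal ((deriv h t)\<^sup>2) * indicator {0..1} t \<le> G t"
      by eventually_elim (auto simp: indicator_def)
  qed
  also note G(2)
  finally have I: "?I \<le> ennreal c" .
  then obtain i where i: "?I = ennreal i" "0 \<le> i" by (cases ?I) (auto simp: top_unique)
  then have "i \<le> c" using I c by (simp add: ennreal_le_iff)
  then show ?thesis
    unfolding energy_norm_def ennreal_powr_def i(1) using i(2)
    by (simp add: powr_half_sqrt ennreal_leI)
qed

lemma taut_string_energy_le_cost:
  fixes w :: "real \<Rightarrow> real" and \<delta> r \<eta> R :: real and n :: nat
  assumes \<delta>: "0 < \<delta>" and r: "0 < r" and \<eta>: "0 \<le> \<eta>" and w0: "w 0 = 0" and R: "R = r + \<eta>" and n: "\<delta> * n = 1"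
    and osc: "\<And>s t. 0 \<le> s \<Longrightarrow> s \<le> t \<Longrightarrow> t \<le> 1 \<Longrightarrow> t - s \<le> \<delta> \<Longrightarrow> \<bar>w t - w s\<bar> \<le> \<eta>"
  shows "taut_string_energy w (2 * R) \<le> ennreal (sqrt (cost r R \<delta> (\<lambda>k. w (\<delta> * Suc k) - w (\<delta> * k)) n))"
proof -
  let ?x = "\<lambda>k. w (\<delta> * Suc k) - w (\<delta> * k)"
  obtain h G where h: "lipschitz_real h" "h 0 = 0" "energy_density h G"
      "(\<integral>\<^sup>+t. G t \<partial>lborel) \<le> ennreal (cost r R \<delta> ?x n)"
    and close: "\<And>t. t \<in> {0..1} \<Longrightarrow> \<bar>h t - w t\<bar> \<le> 2 * R"
    using string_through_restarts[of \<delta> r \<eta> w R n n] assms unfolding n by auto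
  have "sup_norm (\<lambda>t. h t - w t) \<le> ennreal (2 * R)"
    unfolding sup_norm_def by (intro SUP_least ennreal_leI close)
  then have "taut_string_energy w (2 * R) \<le> energy_norm h"
    unfolding taut_string_energy_def
    using lipschitz_imp_abs_continuous[OF h(1)] h(2) by (intro Inf_lower) blast
  also have "\<dots> \<le> ennreal (sqrt (cost r R \<delta> ?x n))"
    using energy_norm_le[OF h(3,4)] \<delta> by (simp add: cost_nonneg)
  finally show ?thesis .
qed


section \<open>The expected cost of the string\<close>

text \<open>An upper bound for the expected charge \<open>R\<^sup>2 / T\<close> of the piece in progress, when the walk is at \<open>y\<close> and the piece has age \<open>A\<close>;
here \<open>T\<close> is the age at which the piece will be completed. The charge is written as an integral of
exponentials in \<open>T\<close>, and optional stopping of the \<open>cosh\<close> martingale bounds the mean of each of them.\<close>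
definition potential :: "real \<Rightarrow> real \<Rightarrow> real \<Rightarrow> real \<Rightarrow> ennreal" where
  "potential r R y A = (\<integral>\<^sup>+b\<in>{0..}. ennreal ((R / r)\<^sup>2 * (b / cosh b) * exp (- (b\<^sup>2 / 2) * (A / r\<^sup>2)) * cosh (b / r * y)) \<partial>lborel)"

lemma potential_measurable [measurable (raw)]:
  assumes [measurable]: "f \<in> borel_measurable N" "g \<in> borel_measurable N"
  shows "(\<lambda>\<omega>. potential r R (f \<omega>) (g \<omega>)) \<in> borel_measurable N"
  unfolding potential_def by measurable

lemma potential_0: "potential r R 0 0 = ennreal ((R / r)\<^sup>2) * (\<integral>\<^sup>+x\<in>{0..}. ennreal (x / cosh x) \<partial>lborel)"
  unfolding potential_def
  by (subst nn_integral_cmult[symmetric]) (auto intro!: nn_integral_cong simp: indicator_def simp flip: ennreal_mult')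

lemma potential_ge:
  assumes r: "0 < r" and A: "0 < A" and y: "r \<le> \<bar>y\<bar>"
  shows "ennreal (R\<^sup>2 / A) \<le> potential r R y A"
proof -
  define t where "t = A / r\<^sup>2"
  have t: "0 < t" using r A by (simp add: t_def)
  have "ennreal (R\<^sup>2 / A) = ennreal ((R / r)\<^sup>2) * inverse (ennreal t)"
    using r A t by (simp add: t_def inverse_ennreal power_divide flip: ennreal_mult)
  also have "\<dots> = (\<integral>\<^sup>+b. ennreal ((R / r)\<^sup>2) * (ennreal (b * discount (b\<^sup>2 / 2) (ennreal t)) * indicator {0..} b) \<partial>lborel)"
    using t by (subst inverse_eq_nn_integral_discount, simp)
      (unfold discount_def, rule nn_integral_cmult[symmetric], measurable)
  also have "\<dots> \<le> potential r R y A"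
    unfolding potential_def
  proof (rule nn_integral_mono)
    fix b :: real
    show "ennreal ((R / r)\<^sup>2) * (ennreal (b * discount (b\<^sup>2 / 2) (ennreal t)) * indicator {0..} b)
        \<le> ennreal ((R / r)\<^sup>2 * (b / cosh b) * exp (- (b\<^sup>2 / 2) * (A / r\<^sup>2)) * cosh (b / r * y)) * indicator {0..} b"
    proof (cases "0 \<le> b")
      case True
      have "b * 1 \<le> b * (\<bar>y\<bar> / r)" using True y r by (intro mult_left_mono) auto
      then have "cosh b \<le> cosh (b / r * y)"
        using True r by (intro cosh_abs_mono) (simp add: abs_mult)
      then have "1 \<le> cosh (b / r * y) / cosh b" by simp
      then have "b * exp (- (b\<^sup>2 / 2) * t) * 1 \<le> b * exp (- (b\<^sup>2 / 2) * t) * (cosh (b / r * y) / cosh b)"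
        using True by (intro mult_left_mono) auto
      then have "(R / r)\<^sup>2 * (b * exp (- (b\<^sup>2 / 2) * t)) \<le> (R / r)\<^sup>2 * (b * exp (- (b\<^sup>2 / 2) * t) * (cosh (b / r * y) / cosh b))"
        by (intro mult_left_mono) auto
      then show ?thesis
        using True t unfolding t_def[symmetric] discount_def
        by (auto intro!: ennreal_leI simp: mult_ac simp flip: ennreal_mult')
    qed simp
  qed
  finally show ?thesis .
qed

lemma offset_age_restrict:
  "j \<le> k \<Longrightarrow> offset r (restrict x {..<k}) j = offset r x j \<and> age r \<delta> (restrict x {..<k}) j = age r \<delta> x j"
  by (induction j) auto

lemma offset_age_measurable:
  assumes "j \<le> k"
  shows "(\<lambda>x. offset r x j) \<in> borel_measurable (PiM {..<k} (\<lambda>_. borel))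
      \<and> (\<lambda>x. age r \<delta> x j) \<in> borel_measurable (PiM {..<k} (\<lambda>_. borel))"
  using assms
proof (induction j)
  case (Suc j)
  then have [measurable]: "(\<lambda>x. offset r x j) \<in> borel_measurable (PiM {..<k} (\<lambda>_. borel))"
      "(\<lambda>x. age r \<delta> x j) \<in> borel_measurable (PiM {..<k} (\<lambda>_. borel))"
      "(\<lambda>x. x j) \<in> borel_measurable (PiM {..<k} (\<lambda>_. borel :: real measure))"
    by (auto intro!: measurable_component_singleton)
  show ?case by simp
qed simp

lemma
  shows offset_restrict: "offset r (restrict x {..<k}) k = offset r x k"
    and age_restrict: "age r \<delta> (restrict x {..<k}) k = age r \<delta> x k"
    and offset_measurable: "(\<lambda>x. offset r x k) \<in> borel_measurable (PiM {..<k} (\<lambda>_. borel))"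
    and age_measurable: "(\<lambda>x. age r \<delta> x k) \<in> borel_measurable (PiM {..<k} (\<lambda>_. borel))"
  using offset_age_restrict[of k k r x \<delta>] offset_age_measurable[of k k r \<delta>] by blast+

context gaussian_walk
begin

abbreviation X :: "real \<Rightarrow> nat \<Rightarrow> 'a \<Rightarrow> real" where "X r k \<omega> \<equiv> offset r (\<lambda>i. \<xi> i \<omega>) k"
abbreviation A :: "real \<Rightarrow> nat \<Rightarrow> 'a \<Rightarrow> real" where "A r k \<omega> \<equiv> age r \<delta> (\<lambda>i. \<xi> i \<omega>) k"

lemma X_measurable [measurable]: "X r k \<in> borel_measurable M"
  by (rule past_random_variable[OF offset_measurable offset_restrict])

lemma A_measurable [measurable]: "A r k \<in> borel_measurable M"
  by (rule past_random_variable[OF age_measurable age_restrict])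

lemma cost_measurable [measurable]: "(\<lambda>\<omega>. cost r R \<delta> (\<lambda>i. \<xi> i \<omega>) k) \<in> borel_measurable M"
  by (induction k) auto

text \<open>Each integrand is a multiple of the \<open>cosh\<close> martingale with rate \<open>b / r\<close>, and Tonelli's theorem carries
this over to the integral.\<close>
lemma potential_martingale:
  assumes r: "0 < r"
  shows "(\<integral>\<^sup>+\<omega>. potential r R (X r k \<omega> + \<xi> k \<omega>) (A r k \<omega> + \<delta>) \<partial>M) = (\<integral>\<^sup>+\<omega>. potential r R (X r k \<omega>) (A r k \<omega>) \<partial>M)"
proof -
  interpret pair_sigma_finite M lborel ..
  let ?f = "\<lambda>b a y. ennreal ((R / r)\<^sup>2 * (b / cosh b) * exp (- (b\<^sup>2 / 2) * (a / r\<^sup>2)) * cosh (b / r * y)) * indicator {0..} b"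
  have swap: "(\<integral>\<^sup>+\<omega>. potential r R (Y \<omega>) (B \<omega>) \<partial>M) = (\<integral>\<^sup>+b. \<integral>\<^sup>+\<omega>. ?f b (B \<omega>) (Y \<omega>) \<partial>M \<partial>lborel)"
    if [measurable]: "Y \<in> borel_measurable M" "B \<in> borel_measurable M" for Y B
    unfolding potential_def by (rule Fubini'[symmetric]) measurable
  have "(\<integral>\<^sup>+\<omega>. ?f b (A r k \<omega> + \<delta>) (X r k \<omega> + \<xi> k \<omega>) \<partial>M) = (\<integral>\<^sup>+\<omega>. ?f b (A r k \<omega>) (X r k \<omega>) \<partial>M)" for b
  proof (cases "0 \<le> b")
    case True
    define g where "g a = (R / r)\<^sup>2 * (b / cosh b) * exp (- (b\<^sup>2 / 2) * (a / r\<^sup>2))" for a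
    have g: "0 \<le> g a" for a using True by (simp add: g_def)
    have [measurable]: "g \<in> borel_measurable borel" unfolding g_def by measurable
    have shift: "exp ((b / r)\<^sup>2 * \<delta> / 2) * g (a + \<delta>) = g a" for a
    proof -
      have "exp ((b / r)\<^sup>2 * \<delta> / 2) * exp (- (b\<^sup>2 / 2) * ((a + \<delta>) / r\<^sup>2)) = exp (- (b\<^sup>2 / 2) * (a / r\<^sup>2))"
        by (simp add: power_divide add_divide_distrib algebra_simps flip: exp_add)
      then show ?thesis unfolding g_def by (simp add: mult.left_commute)
    qed
    have "(\<integral>\<^sup>+\<omega>. ?f b (A r k \<omega> + \<delta>) (X r k \<omega> + \<xi> k \<omega>) \<partial>M)
        = (\<integral>\<^sup>+\<omega>. ennreal (g (A r k \<omega> + \<delta>)) * ennreal (cosh (b / r * (X r k \<omega> + \<xi> k \<omega>))) \<partial>M)"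
      using True g unfolding g_def[symmetric] by (simp flip: ennreal_mult)
    also have "\<dots> = ennreal (exp ((b / r)\<^sup>2 * \<delta> / 2)) * (\<integral>\<^sup>+\<omega>. ennreal (g (A r k \<omega> + \<delta>)) * ennreal (cosh (b / r * X r k \<omega>)) \<partial>M)"
    proof (rule nn_integral_cosh_martingale[where X="\<lambda>x. offset r x k" and F="\<lambda>x. ennreal (g (age r \<delta> x k + \<delta>))"])
      have [measurable]: "(\<lambda>x. age r \<delta> x k) \<in> borel_measurable (PiM {..<k} (\<lambda>_. borel))"
        by (rule age_measurable)
      show "(\<lambda>x. ennreal (g (age r \<delta> x k + \<delta>))) \<in> borel_measurable (PiM {..<k} (\<lambda>_. borel))"
        by measurable
    qed (simp_all only: age_restrict offset_restrict offset_measurable)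
    also have "\<dots> = (\<integral>\<^sup>+\<omega>. ?f b (A r k \<omega>) (X r k \<omega>) \<partial>M)"
    proof (subst nn_integral_cmult[symmetric])
      show "(\<lambda>\<omega>. ennreal (g (A r k \<omega> + \<delta>)) * ennreal (cosh (b / r * X r k \<omega>))) \<in> borel_measurable M"
        by measurable
      have "ennreal (exp ((b / r)\<^sup>2 * \<delta> / 2)) * (ennreal (g (a + \<delta>)) * ennreal (cosh (b / r * y))) = ?f b a y" for a y
        unfolding g_def[symmetric] using True g shift[of a] by (simp flip: ennreal_mult mult.assoc)
      then show "(\<integral>\<^sup>+\<omega>. ennreal (exp ((b / r)\<^sup>2 * \<delta> / 2)) * (ennreal (g (A r k \<omega> + \<delta>)) * ennreal (cosh (b / r * X r k \<omega>))) \<partial>M)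
          = (\<integral>\<^sup>+\<omega>. ?f b (A r k \<omega>) (X r k \<omega>) \<partial>M)"
        by (simp only:)
    qed
    finally show ?thesis .
  qed simp
  then show ?thesis by (simp add: swap)
qed

lemma integrable_step: "integrable M (\<xi> k)" and expectation_step: "expectation (\<xi> k) = 0"
  and integrable_step_square: "integrable M (\<lambda>\<omega>. (\<xi> k \<omega>)\<^sup>2)" and expectation_step_square: "expectation (\<lambda>\<omega>. (\<xi> k \<omega>)\<^sup>2) = \<delta>"
proof -
  let ?s = "sqrt \<delta>"
  have s: "0 < ?s" using step_pos by simp
  show "integrable M (\<xi> k)"
    using distributed_integrable[OF steps_normal[of k], of "\<lambda>x. x"] integrable_normal_moment_nz_1[OF s, of 0] by simp
  show "expectation (\<xi> k) = 0"
    by (rule normal_distributed_expectation[OF s steps_normal])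
  show "integrable M (\<lambda>\<omega>. (\<xi> k \<omega>)\<^sup>2)"
    using distributed_integrable[OF steps_normal[of k], of "\<lambda>x. x\<^sup>2"] integrable_normal_moment[OF s, of 0 2] by simp
  show "expectation (\<lambda>\<omega>. (\<xi> k \<omega>)\<^sup>2) = \<delta>"
    using distributed_integral[OF steps_normal[of k], of "\<lambda>x. x\<^sup>2"] integral_normal_moment_even[OF s, of 0 1] step_pos
    by simp
qed

text \<open>The cross term vanishes by independence; it is integrable because the restarted walk is bounded.\<close>
lemma square_step:
  assumes r: "0 < r"
  shows "(\<integral>\<^sup>+\<omega>. ennreal ((X r k \<omega> + \<xi> k \<omega>)\<^sup>2) \<partial>M) = (\<integral>\<^sup>+\<omega>. ennreal ((X r k \<omega>)\<^sup>2) \<partial>M) + ennreal \<delta>"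
proof -
  have bound: "\<bar>X r k \<omega>\<bar> \<le> r" for \<omega> using abs_offset_less[OF r] by (rule less_imp_le)
  have intX: "integrable M (X r k)"
    by (rule integrable_const_bound[of _ r]) (auto simp: bound)
  have intX2: "integrable M (\<lambda>\<omega>. (X r k \<omega>)\<^sup>2)"
    using bound r by (intro integrable_const_bound[of _ "r\<^sup>2"]) (auto simp: abs_le_square_iff[symmetric])
  have ind: "indep_var borel (X r k) borel (\<xi> k)"
    by (rule indep_past_next[OF offset_measurable offset_restrict, where g="\<lambda>x. x"]) simp
  have cross: "integrable M (\<lambda>\<omega>. X r k \<omega> * \<xi> k \<omega>)" "expectation (\<lambda>\<omega>. X r k \<omega> * \<xi> k \<omega>) = 0"
    using indep_var_integrable[OF ind intX integrable_step] indep_var_lebesgue_integral[OF ind intX integrable_step]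
    by (simp_all add: expectation_step)
  have eq: "(X r k \<omega> + \<xi> k \<omega>)\<^sup>2 = (X r k \<omega>)\<^sup>2 + 2 * (X r k \<omega> * \<xi> k \<omega>) + (\<xi> k \<omega>)\<^sup>2" for \<omega>
    by (simp add: power2_sum)
  have int: "integrable M (\<lambda>\<omega>. (X r k \<omega> + \<xi> k \<omega>)\<^sup>2)"
    unfolding eq by (intro Bochner_Integration.integrable_add intX2 integrable_mult_right cross(1) integrable_step_square)
  have "expectation (\<lambda>\<omega>. (X r k \<omega> + \<xi> k \<omega>)\<^sup>2) = expectation (\<lambda>\<omega>. (X r k \<omega>)\<^sup>2) + \<delta>"
    unfolding eq using intX2 cross integrable_step_square by (simp add: expectation_step_square)
  then show ?thesis
    using int intX2 step_pos by (simp add: nn_integral_eq_integral)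
qed

text \<open>This replaces the renewal argument for the number of pieces. Let \<open>K\<close> be the potential of a new
piece. The sum of the charges so far, the potential of the piece in progress and \<open>K X\<^sup>2 / r\<^sup>2\<close> grows in
expectation by at most \<open>K \<delta> / r\<^sup>2\<close> per step. Indeed, without a restart only the last term drifts, by the
variance \<open>\<delta>\<close> of the step. At a restart the charge is covered by the potential, and the potential \<open>K\<close> of the
next piece is covered by \<open>K y\<^sup>2 / r\<^sup>2\<close>, since \<open>\<bar>y\<bar> \<ge> r\<close>.\<close>
lemma expected_cost_le:
  fixes r R :: real
  assumes r: "0 < r"
  defines "K \<equiv> potential r R 0 0"
  shows "(\<integral>\<^sup>+\<omega>. ennreal (cost r R \<delta> (\<lambda>i. \<xi> i \<omega>) n) \<partial>M) \<le> K * ennreal (1 + \<delta> * n / r\<^sup>2)"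
proof -
  define \<Phi> where "\<Phi> k \<omega> = ennreal (cost r R \<delta> (\<lambda>i. \<xi> i \<omega>) k) + potential r R (X r k \<omega>) (A r k \<omega>)
      + K * ennreal (1 / r\<^sup>2) * ennreal ((X r k \<omega>)\<^sup>2)" for k \<omega>
  have step: "\<Phi> (Suc k) \<omega> \<le> ennreal (cost r R \<delta> (\<lambda>i. \<xi> i \<omega>) k) + potential r R (X r k \<omega> + \<xi> k \<omega>) (A r k \<omega> + \<delta>)
      + K * ennreal (1 / r\<^sup>2) * ennreal ((X r k \<omega> + \<xi> k \<omega>)\<^sup>2)" for k \<omega>
  proof (cases "r \<le> \<bar>X r k \<omega> + \<xi> k \<omega>\<bar>")
    case False
    then show ?thesis by (simp add: \<Phi>_def)
  next
    case True
    have pos: "0 < A r k \<omega> + \<delta>" using step_pos age_nonneg[of \<delta>] by (simp add: add_nonneg_pos)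
    have "r\<^sup>2 \<le> (X r k \<omega> + \<xi> k \<omega>)\<^sup>2" using True r by (simp add: abs_le_square_iff[symmetric])
    then have "1 \<le> 1 / r\<^sup>2 * (X r k \<omega> + \<xi> k \<omega>)\<^sup>2" using r by simp
    then have "ennreal 1 \<le> ennreal (1 / r\<^sup>2) * ennreal ((X r k \<omega> + \<xi> k \<omega>)\<^sup>2)"
      by (subst ennreal_mult[symmetric]) (auto intro: ennreal_leI)
    then have K: "K * 1 \<le> K * (ennreal (1 / r\<^sup>2) * ennreal ((X r k \<omega> + \<xi> k \<omega>)\<^sup>2))"
      by (intro mult_left_mono) auto
    have "\<Phi> (Suc k) \<omega> = ennreal (cost r R \<delta> (\<lambda>i. \<xi> i \<omega>) k) + ennreal (R\<^sup>2 / (A r k \<omega> + \<delta>)) + K * 1"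
      unfolding \<Phi>_def K_def using True pos step_pos by (simp add: cost_nonneg)
    also have "\<dots> \<le> ennreal (cost r R \<delta> (\<lambda>i. \<xi> i \<omega>) k) + potential r R (X r k \<omega> + \<xi> k \<omega>) (A r k \<omega> + \<delta>)
        + K * (ennreal (1 / r\<^sup>2) * ennreal ((X r k \<omega> + \<xi> k \<omega>)\<^sup>2))"
      by (intro add_mono order_refl potential_ge r pos True K)
    finally show ?thesis by (simp add: mult.assoc)
  qed
  have "(\<integral>\<^sup>+\<omega>. \<Phi> k \<omega> \<partial>M) \<le> K + of_nat k * (K * ennreal (1 / r\<^sup>2) * ennreal \<delta>)" for k
  proof (induction k)
    case 0
    show ?case by (simp add: \<Phi>_def K_def emeasure_space_1)
  next
    case (Suc k)
    have "(\<integral>\<^sup>+\<omega>. \<Phi> (Suc k) \<omega> \<partial>M) \<le> (\<integral>\<^sup>+\<omega>. ennreal (cost r R \<delta> (\<lambda>i. \<xi> i \<omega>) k) + potential r R (X r k \<omega> + \<xi> k \<omega>) (A r k \<omega> + \<delta>)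
      + K * ennreal (1 / r\<^sup>2) * ennreal ((X r k \<omega> + \<xi> k \<omega>)\<^sup>2) \<partial>M)"
      by (intro nn_integral_mono step)
    also have "\<dots> = (\<integral>\<^sup>+\<omega>. ennreal (cost r R \<delta> (\<lambda>i. \<xi> i \<omega>) k) \<partial>M) + (\<integral>\<^sup>+\<omega>. potential r R (X r k \<omega>) (A r k \<omega>) \<partial>M)
      + K * ennreal (1 / r\<^sup>2) * ((\<integral>\<^sup>+\<omega>. ennreal ((X r k \<omega>)\<^sup>2) \<partial>M) + ennreal \<delta>)"
      by (simp add: nn_integral_add nn_integral_cmult potential_martingale[OF r] square_step[OF r])
    also have "\<dots> = (\<integral>\<^sup>+\<omega>. \<Phi> k \<omega> \<partial>M) + K * ennreal (1 / r\<^sup>2) * ennreal \<delta>"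
      unfolding \<Phi>_def by (simp add: nn_integral_add nn_integral_cmult distrib_left add.assoc)
    also have "\<dots> \<le> K + of_nat k * (K * ennreal (1 / r\<^sup>2) * ennreal \<delta>) + K * ennreal (1 / r\<^sup>2) * ennreal \<delta>"
      by (intro add_right_mono Suc.IH)
    finally show ?case by (simp only: of_nat_Suc distrib_right mult_1 add_ac)
  qed
  from this[of n] have "(\<integral>\<^sup>+\<omega>. ennreal (cost r R \<delta> (\<lambda>i. \<xi> i \<omega>) n) \<partial>M) \<le> K + of_nat n * (K * ennreal (1 / r\<^sup>2) * ennreal \<delta>)"
    unfolding \<Phi>_def by (elim order_trans[rotated]) (intro nn_integral_mono, simp add: add.assoc)
  also have "of_nat n * (K * ennreal (1 / r\<^sup>2) * ennreal \<delta>) = K * (ennreal (1 / r\<^sup>2) * ennreal \<delta> * of_nat n)"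
    by (simp only: mult_ac)
  also have "ennreal (1 / r\<^sup>2) * ennreal \<delta> * of_nat n = ennreal (\<delta> * n / r\<^sup>2)"
    using step_pos by (simp add: ennreal_of_nat_eq_real_of_nat flip: ennreal_mult)
  also have "K + K * ennreal (\<delta> * n / r\<^sup>2) = K * ennreal (1 + \<delta> * n / r\<^sup>2)"
    using step_pos by (simp add: distrib_left)
  finally show ?thesis .
qed

end


section \<open>The bound for the taut string constant\<close>

lemma rational_near:
  fixes s d :: real
  assumes "s \<in> {0..1}" "0 < d"
  obtains p where "p \<in> \<rat> \<inter> {0..1}" "\<bar>p - s\<bar> < d"
proof -
  have "max 0 (s - d) < min 1 (s + d)" using assms by auto
  then obtain p where "p \<in> \<rat>" "max 0 (s - d) < p" "p < min 1 (s + d)" using Rats_dense_in_real by blast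
  then show ?thesis by (intro that[of p]) auto
qed

lemma oscillation_from_rationals:
  fixes w :: "real \<Rightarrow> real"
  assumes cont: "continuous_on {0..1} w" and \<delta>: "0 < \<delta>"
    and rat: "\<And>p q. p \<in> \<rat> \<inter> {0..1} \<Longrightarrow> q \<in> \<rat> \<inter> {0..1} \<Longrightarrow> \<bar>p - q\<bar> < 2 * \<delta> \<Longrightarrow> \<bar>w p - w q\<bar> \<le> \<eta>"
    and st: "s \<in> {0..1}" "t \<in> {0..1}" "\<bar>t - s\<bar> \<le> \<delta>"
  shows "\<bar>w t - w s\<bar> \<le> \<eta>"
proof (rule field_le_epsilon)
  fix e :: real assume e: "0 < e"
  obtain d where d: "0 < d" "\<And>p. p \<in> {0..1} \<Longrightarrow> dist p s < d \<Longrightarrow> dist (w p) (w s) < e / 2"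
    using cont st(1) e unfolding continuous_on_iff by (metis half_gt_zero)
  obtain d' where d': "0 < d'" "\<And>p. p \<in> {0..1} \<Longrightarrow> dist p t < d' \<Longrightarrow> dist (w p) (w t) < e / 2"
    using cont st(2) e unfolding continuous_on_iff by (metis half_gt_zero)
  obtain p where p: "p \<in> \<rat> \<inter> {0..1}" "\<bar>p - s\<bar> < min d (\<delta> / 2)"
    using rational_near[OF st(1), of "min d (\<delta> / 2)"] d(1) \<delta> by auto
  obtain q where q: "q \<in> \<rat> \<inter> {0..1}" "\<bar>q - t\<bar> < min d' (\<delta> / 2)"
    using rational_near[OF st(2), of "min d' (\<delta> / 2)"] d'(1) \<delta> by auto
  have "\<bar>q - p\<bar> < 2 * \<delta>" using p(2) q(2) st(3) by linarith
  then have "\<bar>w q - w p\<bar> \<le> \<eta>" using p q by (intro rat) auto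
  moreover have "\<bar>w p - w s\<bar> < e / 2" using d(2)[of p] p by (simp add: dist_real_def)
  moreover have "\<bar>w q - w t\<bar> < e / 2" using d'(2)[of q] q by (simp add: dist_real_def)
  ultimately show "\<bar>w t - w s\<bar> \<le> \<eta> + e" by linarith
qed

text \<open>The event that the oscillation over time spans up to \<open>1 / (n + 1)\<close> is at most \<open>\<eta>\<close>, formulated with
rational times to be measurable. The factor 2 leaves room for approximating real times by rational ones.\<close>
definition calm :: "'a measure \<Rightarrow> (real \<Rightarrow> 'a \<Rightarrow> real) \<Rightarrow> real \<Rightarrow> nat \<Rightarrow> 'a set" where
  "calm M W \<eta> n = {\<omega>\<in>space M. \<forall>p\<in>\<rat> \<inter> {0..1}. \<forall>q\<in>\<rat> \<inter> {0..1}. \<bar>p - q\<bar> < 2 / Suc n \<longrightarrow> \<bar>W p \<omega> - W q \<omega>\<bar> \<le> \<eta>}"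

lemma calmD:
  "\<omega> \<in> calm M W \<eta> n \<Longrightarrow> p \<in> \<rat> \<inter> {0..1} \<Longrightarrow> q \<in> \<rat> \<inter> {0..1} \<Longrightarrow> \<bar>p - q\<bar> < 2 / Suc n
    \<Longrightarrow> \<bar>W p \<omega> - W q \<omega>\<bar> \<le> \<eta>"
  unfolding calm_def by blast

lemma calm_measurable:
  assumes "wiener_process M W"
  shows "calm M W \<eta> n \<in> sets M"
proof -
  have W: "W t \<in> borel_measurable M" if "0 \<le> t" for t
    using assms that by (simp add: wiener_process_def)
  have "{\<omega>\<in>space M. \<bar>p - q\<bar> < 2 / Suc n \<longrightarrow> \<bar>W p \<omega> - W q \<omega>\<bar> \<le> \<eta>} \<in> sets M"
    if "p \<in> \<rat> \<inter> {0..1}" "q \<in> \<rat> \<inter> {0..1}" for p q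
  proof -
    have [measurable]: "W p \<in> borel_measurable M" "W q \<in> borel_measurable M" using that W by auto
    show ?thesis by measurable
  qed
  then show ?thesis
    unfolding calm_def by (intro sets.sets_Collect_countable_All' countable_Int1 countable_rat)
qed

lemma emeasure_calm_tendsto:
  assumes W: "wiener_process M W" and \<eta>: "0 < \<eta>"
  shows "(\<lambda>n. emeasure M (calm M W \<eta> n)) \<longlonglongrightarrow> 1"
proof -
  interpret prob_space M using W by (simp add: wiener_process_def)
  have inc: "incseq (calm M W \<eta>)"
  proof (rule incseq_SucI)
    fix n
    have "(2::real) / Suc (Suc n) \<le> 2 / Suc n" by (intro divide_left_mono) auto
    then have *: "\<bar>p - q\<bar> < 2 / Suc (Suc n) \<Longrightarrow> \<bar>p - q\<bar> < 2 / Suc n" for p q :: real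
      by (rule less_le_trans[rotated])
    show "calm M W \<eta> n \<subseteq> calm M W \<eta> (Suc n)"
    proof
      fix \<omega> assume "\<omega> \<in> calm M W \<eta> n"
      then have \<omega>: "\<omega> \<in> space M \<and> (\<forall>p\<in>\<rat> \<inter> {0..1}. \<forall>q\<in>\<rat> \<inter> {0..1}. \<bar>p - q\<bar> < 2 / Suc n \<longrightarrow> \<bar>W p \<omega> - W q \<omega>\<bar> \<le> \<eta>)"
        unfolding calm_def by (rule CollectD)
      show "\<omega> \<in> calm M W \<eta> (Suc n)"
        unfolding calm_def
      proof (intro CollectI conjI ballI impI)
        show "\<omega> \<in> space M" using \<omega> by (rule conjunct1)
      next
        fix p q :: real
        assume pq: "p \<in> \<rat> \<inter> {0..1}" "q \<in> \<rat> \<inter> {0..1}" "\<bar>p - q\<bar> < 2 / real (Suc (Suc n))"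
        show "\<bar>W p \<omega> - W q \<omega>\<bar> \<le> \<eta>"
          using \<omega>[THEN conjunct2, rule_format, OF pq(1,2) *[OF pq(3)]] .
      qed
    qed
  qed
  have sets: "range (calm M W \<eta>) \<subseteq> sets M" by (rule image_subsetI) (rule calm_measurable[OF W])
  have "(\<lambda>n. emeasure M (calm M W \<eta> n)) \<longlonglongrightarrow> emeasure M (\<Union>n. calm M W \<eta> n)"
    by (rule Lim_emeasure_incseq[OF sets inc])
  moreover have "AE \<omega> in M. \<omega> \<in> (\<Union>n. calm M W \<eta> n)"
    using wiener_AE_path[OF W] AE_space
  proof eventually_elim
    case (elim \<omega>)
    have "uniformly_continuous_on {0..1} (\<lambda>t. W t \<omega>)"
      by (intro compact_uniformly_continuous continuous_on_subset[OF conjunct1[OF elim(1)]]) auto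
    then obtain d where d: "0 < d" "\<And>p q. p \<in> {0..1} \<Longrightarrow> q \<in> {0..1} \<Longrightarrow> dist q p < d \<Longrightarrow> dist (W q \<omega>) (W p \<omega>) < \<eta>"
      using \<eta> unfolding uniformly_continuous_on_def by metis
    obtain n where n: "1 / real (Suc n) < d / 2"
      using nat_approx_posE[of "d / 2"] d(1) by auto
    then have n': "2 / real (Suc n) < d" by simp
    have "\<bar>W p \<omega> - W q \<omega>\<bar> \<le> \<eta>" if "p \<in> {0..1}" "q \<in> {0..1}" "\<bar>p - q\<bar> < 2 / Suc n" for p q
      using d(2)[of q p] that n' by (simp add: dist_real_def)
    then have "\<omega> \<in> calm M W \<eta> n" using elim(2) unfolding calm_def by blast
    then show ?case by blast
  qed
  then have "emeasure M (\<Union>n. calm M W \<eta> n) = 1"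
    by (intro emeasure_eq_1_AE sets.countable_UN sets)
  ultimately show ?thesis by simp
qed

lemma ennreal_le_deviation:
  assumes "x \<le> ennreal y" "0 \<le> y" "0 \<le> C"
  shows "ennreal C \<le> e2ennreal \<bar>enn2ereal x - ereal C\<bar> + ennreal y"
proof -
  obtain x' where x': "x = ennreal x'" "0 \<le> x'" using assms(1) by (cases x) (auto simp: top_unique)
  then have "x' \<le> y" using assms by (simp add: ennreal_le_iff)
  then have "C \<le> \<bar>x' - C\<bar> + y" by linarith
  then have "ennreal C \<le> ennreal (\<bar>x' - C\<bar> + y)" by (rule ennreal_leI)
  also have "\<dots> = ennreal \<bar>x' - C\<bar> + ennreal y" using assms(2) by simp
  also have "ennreal \<bar>x' - C\<bar> = e2ennreal \<bar>enn2ereal x - ereal C\<bar>"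
    using x' by (simp add: enn2ereal_ennreal)
  finally show ?thesis .
qed

text \<open>On the calm event the string through the restarts bounds the taut string energy. The mesh tends to 0
while the radius \<open>2 R\<close> is fixed, so that the exceptional event disappears in the limit and only the
expected cost remains, which does not depend on the mesh. The free parameter \<open>s\<close> comes from
\<open>2 z \<le> z\<^sup>2 / s + s\<close>, by which a bound for the mean of the squared energy norm controls the norm. The
deviation need not be measurable in \<open>\<omega>\<close>; therefore everything else is moved to the other side, where the
truncated difference is measurable.\<close>
lemma constant_le_deviation_plus_energy:
  fixes r \<eta> s C j :: real
  defines "R \<equiv> r + \<eta>"
  assumes W: "wiener_process M W" and r: "0 < r" and \<eta>: "0 < \<eta>" and s: "0 < s" and C: "0 \<le> C"
    and J: "(\<integral>\<^sup>+x\<in>{0..}. ennreal (x / cosh x) \<partial>lborel) = ennreal j" "0 \<le> j"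
  shows "ennreal C \<le> (\<integral>\<^sup>+\<omega>. e2ennreal \<bar>enn2ereal (ennreal (2 * R) * taut_string_energy (\<lambda>t. W t \<omega>) (2 * R)) - ereal C\<bar> \<partial>M)
      + ennreal (((2 * R)\<^sup>2 * ((R / r)\<^sup>2 * j * (1 + 1 / r\<^sup>2)) / s + s) / 2)"
proof -
  interpret prob_space M using W by (simp add: wiener_process_def)
  define dev where "dev \<omega> = e2ennreal \<bar>enn2ereal (ennreal (2 * R) * taut_string_energy (\<lambda>t. W t \<omega>) (2 * R)) - ereal C\<bar>" for \<omega>
  define B where "B = ((2 * R)\<^sup>2 * ((R / r)\<^sup>2 * j * (1 + 1 / r\<^sup>2)) / s + s) / 2"
  have R: "0 < R" using r \<eta> by (simp add: R_def)
  have bound: "ennreal C * emeasure M (calm M W \<eta> n) \<le> (\<integral>\<^sup>+\<omega>. dev \<omega> \<partial>M) + ennreal B" for n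
  proof -
    define \<delta> where "\<delta> = 1 / real (Suc n)"
    have \<delta>: "0 < \<delta>" "\<delta> * Suc n = 1" by (auto simp: \<delta>_def)
    interpret gaussian_walk M "increments W \<delta>" \<delta> by (rule wiener_gaussian_walk[OF W \<delta>(1)])
    define c where "c \<omega> = cost r R \<delta> (\<lambda>i. increments W \<delta> i \<omega>) (Suc n)" for \<omega>
    have c0: "0 \<le> c \<omega>" for \<omega> using \<delta>(1) unfolding c_def by (intro cost_nonneg) simp
    have mc [measurable]: "c \<in> borel_measurable M" unfolding c_def by (rule cost_measurable)
    define Y where "Y \<omega> = ennreal ((2 * R)\<^sup>2 / (2 * s)) * ennreal (c \<omega>) + ennreal (s / 2)" for \<omega>
    have [measurable]: "Y \<in> borel_measurable M" unfolding Y_def by measurable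
    have "(\<integral>\<^sup>+\<omega>. Y \<omega> \<partial>M) = ennreal ((2 * R)\<^sup>2 / (2 * s)) * (\<integral>\<^sup>+\<omega>. ennreal (c \<omega>) \<partial>M) + ennreal (s / 2)"
      unfolding Y_def by (simp add: nn_integral_add nn_integral_cmult emeasure_space_1)
    also have "(\<integral>\<^sup>+\<omega>. ennreal (c \<omega>) \<partial>M) \<le> ennreal ((R / r)\<^sup>2) * ennreal j * ennreal (1 + 1 / r\<^sup>2)"
      using expected_cost_le[OF r, of R "Suc n"] unfolding c_def potential_0 J(1) \<delta>(2) .
    also have "ennreal ((2 * R)\<^sup>2 / (2 * s)) * (ennreal ((R / r)\<^sup>2) * ennreal j * ennreal (1 + 1 / r\<^sup>2)) + ennreal (s / 2) = ennreal B"
    proof -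
      have "(2 * R)\<^sup>2 / (2 * s) * ((R / r)\<^sup>2 * j * (1 + 1 / r\<^sup>2)) + s / 2 = B" by (simp add: B_def add_divide_distrib)
      then show ?thesis using s J(2) by (simp flip: ennreal_mult ennreal_plus)
    qed
    finally have intY: "(\<integral>\<^sup>+\<omega>. Y \<omega> \<partial>M) \<le> ennreal B" by (simp add: add_right_mono mult_left_mono)
    have [measurable]: "calm M W \<eta> n \<in> sets M" by (rule calm_measurable[OF W])
    have "AE \<omega> in M. ennreal C * indicator (calm M W \<eta> n) \<omega> - Y \<omega> \<le> dev \<omega>"
      using wiener_AE_path[OF W]
    proof eventually_elim
      case (elim \<omega>)
      show ?case
      proof (cases "\<omega> \<in> calm M W \<eta> n")
        case True
        have cont: "continuous_on {0..1} (\<lambda>t. W t \<omega>)" by (rule continuous_on_subset[OF conjunct1[OF elim]]) auto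
        have "\<bar>W t \<omega> - W u \<omega>\<bar> \<le> \<eta>" if "0 \<le> u" "u \<le> t" "t \<le> 1" "t - u \<le> \<delta>" for u t
        proof (rule oscillation_from_rationals[OF cont \<delta>(1)])
          fix p q :: real assume "p \<in> \<rat> \<inter> {0..1}" "q \<in> \<rat> \<inter> {0..1}" "\<bar>p - q\<bar> < 2 * \<delta>"
          then show "\<bar>W p \<omega> - W q \<omega>\<bar> \<le> \<eta>"
            using calmD[OF True] unfolding \<delta>_def by simp
        qed (use that in auto)
        then have "taut_string_energy (\<lambda>t. W t \<omega>) (2 * R) \<le> ennreal (sqrt (c \<omega>))"
          using taut_string_energy_le_cost[of \<delta> r \<eta> "\<lambda>t. W t \<omega>" R "Suc n"] \<delta> r \<eta> elim
          unfolding c_def increments_def R_def by simp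
        then have "ennreal (2 * R) * taut_string_energy (\<lambda>t. W t \<omega>) (2 * R) \<le> ennreal (2 * R) * ennreal (sqrt (c \<omega>))"
          by (rule mult_left_mono) simp
        also have "\<dots> = ennreal (2 * R * sqrt (c \<omega>))" using R c0 by (simp add: ennreal_mult)
        finally have "ennreal C \<le> dev \<omega> + ennreal (2 * R * sqrt (c \<omega>))"
          unfolding dev_def using R C c0 by (intro ennreal_le_deviation) auto
        also have "2 * R * sqrt (c \<omega>) \<le> (2 * R)\<^sup>2 / (2 * s) * c \<omega> + s / 2"
        proof -
          define z where "z = 2 * R * sqrt (c \<omega>)"
          have z: "z\<^sup>2 / (2 * s) = (2 * R)\<^sup>2 / (2 * s) * c \<omega>" using c0 by (simp add: z_def power_mult_distrib)
          have "0 \<le> (z - s)\<^sup>2 / (2 * s)" using s by simp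
          also have "(z - s)\<^sup>2 / (2 * s) = z\<^sup>2 / (2 * s) + s / 2 - z"
            using s by (simp add: power2_eq_square field_simps)
          finally have "z \<le> z\<^sup>2 / (2 * s) + s / 2" by simp
          then show ?thesis unfolding z unfolding z_def .
        qed
        also have "ennreal ((2 * R)\<^sup>2 / (2 * s) * c \<omega> + s / 2) = Y \<omega>"
          unfolding Y_def using s c0[of \<omega>] by (simp flip: ennreal_mult ennreal_plus)
        finally have "ennreal C \<le> dev \<omega> + Y \<omega>" by (simp add: ennreal_leI add_left_mono)
        then show ?thesis using True by (simp add: ennreal_minus_le_iff add.commute)
      qed simp
    qed
    then have diff: "(\<integral>\<^sup>+\<omega>. ennreal C * indicator (calm M W \<eta> n) \<omega> - Y \<omega> \<partial>M) \<le> (\<integral>\<^sup>+\<omega>. dev \<omega> \<partial>M)"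
      by (rule nn_integral_mono_AE)
    have "ennreal C * emeasure M (calm M W \<eta> n) = (\<integral>\<^sup>+\<omega>. ennreal C * indicator (calm M W \<eta> n) \<omega> \<partial>M)"
      by (simp add: nn_integral_cmult_indicator)
    also have "\<dots> \<le> (\<integral>\<^sup>+\<omega>. (ennreal C * indicator (calm M W \<eta> n) \<omega> - Y \<omega>) + Y \<omega> \<partial>M)"
      by (intro nn_integral_mono) (auto simp: diff_add_self_ennreal not_le less_imp_le)
    also have "\<dots> = (\<integral>\<^sup>+\<omega>. ennreal C * indicator (calm M W \<eta> n) \<omega> - Y \<omega> \<partial>M) + (\<integral>\<^sup>+\<omega>. Y \<omega> \<partial>M)"
      by (rule nn_integral_add) measurable
    also have "\<dots> \<le> (\<integral>\<^sup>+\<omega>. dev \<omega> \<partial>M) + ennreal B" by (intro add_mono diff intY)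
    finally show ?thesis .
  qed
  have "(\<lambda>n. ennreal C * emeasure M (calm M W \<eta> n)) \<longlonglongrightarrow> ennreal C * 1"
    by (intro ennreal_tendsto_cmult emeasure_calm_tendsto W \<eta>) simp
  then have "ennreal C * 1 \<le> (\<integral>\<^sup>+\<omega>. dev \<omega> \<partial>M) + ennreal B"
    by (rule LIMSEQ_le_const2) (use bound in blast)
  then show ?thesis by (simp add: dev_def B_def)
qed

lemma taut_string_constant_le:
  assumes W: "wiener_process M W" and C: "is_taut_string_constant M W C"
  shows "C \<le> 2 * sqrt (enn2real (\<integral>\<^sup>+x\<in>{0..}. ennreal (x / cosh x) \<partial>lborel))"
proof -
  define j where "j = enn2real (\<integral>\<^sup>+x\<in>{0..}. ennreal (x / cosh x) \<partial>lborel)"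
  have J: "(\<integral>\<^sup>+x\<in>{0..}. ennreal (x / cosh x) \<partial>lborel) = ennreal j" "0 \<le> j"
    using nn_integral_x_over_cosh_finite by (auto simp: j_def)
  define dev where "dev \<epsilon> = (\<integral>\<^sup>+\<omega>. e2ennreal \<bar>enn2ereal (ennreal \<epsilon> * taut_string_energy (\<lambda>t. W t \<omega>) \<epsilon>) - ereal C\<bar> \<partial>M)" for \<epsilon>
  have C0: "0 \<le> C" using C by (simp add: is_taut_string_constant_def)
  have powr_1: "ennreal_powr x 1 = x" for x
    by (cases x) (auto simp: ennreal_powr_def)
  have dev: "(dev \<longlongrightarrow> 0) (at_right 0)"
    using C unfolding is_taut_string_constant_def dev_def[abs_def] by (auto dest!: spec[of _ 1] simp: powr_1)
  have young: "C \<le> (4 * j / s + s) / 2" if s: "0 < s" for s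
  proof -
    \<comment> \<open>The overshoot margin \<open>\<eta> = \<epsilon>\<^sup>2 / 2\<close> is negligible compared with \<open>r = (1 - \<epsilon>) \<epsilon> / 2\<close>, and \<open>2 (r + \<eta>) = \<epsilon>\<close>.\<close>
    define B where "B \<epsilon> = (\<epsilon>\<^sup>2 * ((1 / (1 - \<epsilon>))\<^sup>2 * j * (1 + 1 / ((1 - \<epsilon>) * \<epsilon> / 2)\<^sup>2)) / s + s) / 2" for \<epsilon> :: real
    have "\<forall>\<^sub>F \<epsilon> in at_right 0. ennreal C \<le> dev \<epsilon> + ennreal (B \<epsilon>)"
    proof (rule eventually_at_rightI[of 0 1])
      fix \<epsilon> :: real assume "\<epsilon> \<in> {0<..<1}"
      then have \<epsilon>: "0 < \<epsilon>" "\<epsilon> < 1" by auto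
      have R: "(1 - \<epsilon>) * \<epsilon> / 2 + \<epsilon> * \<epsilon> / 2 = \<epsilon> / 2" by (simp add: field_simps)
      have q: "\<epsilon> / 2 / ((1 - \<epsilon>) * \<epsilon> / 2) = 1 / (1 - \<epsilon>)" using \<epsilon> by simp
      show "ennreal C \<le> dev \<epsilon> + ennreal (B \<epsilon>)"
        using constant_le_deviation_plus_energy[OF W _ _ s C0 J, of "(1 - \<epsilon>) * \<epsilon> / 2" "\<epsilon> * \<epsilon> / 2"] \<epsilon>
        unfolding R q by (simp add: dev_def B_def)
    qed simp
    moreover have "(B \<longlongrightarrow> (j * inverse ((1 / 2)\<^sup>2) * inverse s + s) / 2) (at_right 0)"
      unfolding B_def using s by real_asymp
    then have "(B \<longlongrightarrow> (4 * j / s + s) / 2) (at_right 0)"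
      by (simp add: power2_eq_square field_simps)
    then have "((\<lambda>\<epsilon>. dev \<epsilon> + ennreal (B \<epsilon>)) \<longlongrightarrow> 0 + ennreal ((4 * j / s + s) / 2)) (at_right 0)"
      by (intro tendsto_add dev tendsto_ennrealI)
    ultimately have "ennreal C \<le> 0 + ennreal ((4 * j / s + s) / 2)"
      by (intro tendsto_lowerbound) auto
    then show ?thesis using s J(2) by (simp add: ennreal_le_iff)
  qed
  have "C \<le> 2 * sqrt j + e" if e: "0 < e" for e
  proof -
    \<comment> \<open>The optimal choice is \<open>s = 2 sqrt j\<close>; the summand \<open>e\<close> avoids dividing by 0 when \<open>j = 0\<close>.\<close>
    define s where "s = 2 * sqrt j + e"
    have s: "0 < s" using e J(2) by (simp add: s_def add_nonneg_pos)
    have "4 * j = (2 * sqrt j)\<^sup>2" using J(2) by (simp add: power_mult_distrib)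
    also have "\<dots> \<le> s\<^sup>2" unfolding s_def using e J(2) by (intro power_mono) auto
    finally have "4 * j / s \<le> s" using s by (simp add: divide_le_eq power2_eq_square)
    have "C \<le> (4 * j / s + s) / 2" by (rule young[OF s])
    also have "\<dots> \<le> (s + s) / 2" using \<open>4 * j / s \<le> s\<close> by simp
    finally show ?thesis by (simp add: s_def)
  qed
  then show ?thesis unfolding j_def[symmetric] by (rule field_le_epsilon)
qed

theorem mainTheorem4:
  fixes M :: "'a measure" and W :: "real \<Rightarrow> 'a \<Rightarrow> real" and E1 E2 :: ennreal
  assumes "wiener_process M W"
  defines "E1 \<equiv> (\<integral>\<^sup>+\<omega>. exit_time W \<omega> \<partial>M)"
  defines "E2 \<equiv> (\<integral>\<^sup>+\<omega>. inverse (exit_time W \<omega>) \<partial>M)"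
  shows "(\<forall>C. is_taut_string_constant M W C \<longrightarrow> C \<le> 2 * sqrt (enn2real (E2 / E1)))
    \<and> E1 = 1
    \<and> E2 = (\<integral>\<^sup>+x\<in>{0..}. ennreal (x / cosh x) \<partial>lborel)
    \<and> E2 < top"
proof -
  have E1: "E1 = 1" unfolding E1_def by (rule expectation_exit_time[OF assms(1)])
  have E2: "E2 = (\<integral>\<^sup>+x\<in>{0..}. ennreal (x / cosh x) \<partial>lborel)"
    unfolding E2_def by (rule expectation_inverse_exit_time[OF assms(1)])
  show ?thesis
    using taut_string_constant_le[OF assms(1)] nn_integral_x_over_cosh_finite
    unfolding E1 E2 by (simp add: divide_ennreal_def)
qed

end
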